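(* Let $n \ge 2$ and let $G(n)$ be one of the groups $GL(n,\mathbb{R})$, $SL(n,\mathbb{R})$, $|SL(n,\mathbb{R})| = \{A \in GL(n,\mathbb{R}) : |\det A| = 1\}$, $GL^{+}(n,\mathbb{R}) = \{A \in GL(n,\mathbb{R}) : \det A > 0\}$. Let $L$ be a Polish group and let $\varphi : L \to \mathbb{R}^n \rtimes G(n)$ be an algebraic isomorphism. Then $\varphi$ is a topological isomorphism; therefore $\mathbb{R}^n \rtimes G(n)$ is an algebraically determined Polish group.
   Context: A Polish group is a topological group whose topology is separable and completely metrizable. An algebraic isomorphism is an isomorphism of abstract groups (no continuity assumed); a topological isomorphism is a group isomorphism that is also a homeomorphism. A Polish group $G$ is algebraically determined if for every Polish group $L$, every algebraic isomorphism $\varphi: L \to G$ is a topological isomorphism. The natural semidirect product $\mathbb{R}^n \rtimes G(n)$ is the set $\mathbb{R}^n \times G(n)$ with multiplication $(x,A)(y,B) = (x + Ay, AB)$ and the product of the usual topologies. *)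

theory Defs
  imports "HOL-Analysis.Analysis" "HOL-Algebra.Group"
begin

text \<open>Groups are carrier-based, so the topology is an abstract one whose underlying set
  is required to be the carrier.\<close>

definition topological_group :: "('a, 'b) monoid_scheme \<Rightarrow> 'a topology \<Rightarrow> bool" where
  "topological_group G T \<longleftrightarrow>
     group G \<and> topspace T = carrier G \<and>
     continuous_map (prod_topology T T) T (\<lambda>(x, y). x \<otimes>\<^bsub>G\<^esub> y) \<and>
     continuous_map T T (\<lambda>x. inv\<^bsub>G\<^esub> x)"

definition polish_group :: "('a, 'b) monoid_scheme \<Rightarrow> 'a topology \<Rightarrow> bool" where
  "polish_group G T \<longleftrightarrow>
     topological_group G T \<and> separable_space T \<and> completely_metrizable_space T"

definition topological_iso ::
    "('a, 'c) monoid_scheme \<Rightarrow> 'a topology \<Rightarrow> ('b, 'd) monoid_scheme \<Rightarrow> 'b topology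
      \<Rightarrow> ('a \<Rightarrow> 'b) \<Rightarrow> bool" where
  "topological_iso L TL G TG \<phi> \<longleftrightarrow> \<phi> \<in> iso L G \<and> homeomorphic_map TL TG \<phi>"

text \<open>HOL cannot quantify over types inside a formula, so the type in which the competing
  groups \<open>L\<close> live is a parameter. A theorem stated for \<open>TYPE('l)\<close> with \<open>'l\<close> a type variable
  covers all of them.\<close>

definition algebraically_determined ::
    "'l itself \<Rightarrow> ('a, 'b) monoid_scheme \<Rightarrow> 'a topology \<Rightarrow> bool" where
  "algebraically_determined _ G TG \<longleftrightarrow>
     polish_group G TG \<and>
     (\<forall>(L :: 'l monoid) TL \<phi>.
        polish_group L TL \<longrightarrow> \<phi> \<in> iso L G \<longrightarrow> topological_iso L TL G TG \<phi>)"

definition GL :: "(real^'n^'n) set" where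
  "GL = {A. invertible A}"

definition SL :: "(real^'n^'n) set" where
  "SL = {A \<in> GL. det A = 1}"

definition abs_SL :: "(real^'n^'n) set" where
  "abs_SL = {A \<in> GL. \<bar>det A\<bar> = 1}"

definition GL_pos :: "(real^'n^'n) set" where
  "GL_pos = {A \<in> GL. det A > 0}"

definition semidirect :: "(real^'n^'n) set \<Rightarrow> ((real^'n) \<times> (real^'n^'n)) monoid" where
  "semidirect S =
     \<lparr> carrier = UNIV \<times> S,
       mult = (\<lambda>(x, A) (y, B). (x + A *v y, A ** B)),
       one = (0, mat 1) \<rparr>"

definition semidirect_topology :: "(real^'n^'n) set \<Rightarrow> ((real^'n) \<times> (real^'n^'n)) topology" where
  "semidirect_topology S = prod_topology euclidean (top_of_set S)"

end

theory Submission
  imports Defs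
begin

text \<open>Transport the topology of \<open>L\<close> to a Polish group topology \<open>T\<close> on the semidirect product;
  the claim is that \<open>T\<close> is the usual topology. By the open mapping theorem for Polish groups it
  suffices that the identity is continuous in one direction. The translations along the \<open>i\<close>-th axis
  and the transvections with a fixed off-diagonal position are intersections of centralizers, hence
  \<open>T\<close>-closed, and both induce Polish group topologies on the real line. Commutators identify all
  these topologies with each other and make multiplication jointly continuous, so the real line
  becomes a Polish ring. Effros' theorem, applied to the action of the invertible elements by
  multiplication with squares, shows that the positive numbers are open, so the topology is the
  Euclidean one. Hence \<open>T\<close> is Euclidean on translations and on transvections. The matrix of a group
  element is then \<open>T\<close>-continuous through its conjugation action on translations, and its
  translation part is recovered near the identity by one step of Gaussian elimination followed by a
  commutator with a diagonal matrix.\<close>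

section \<open>Actions of Polish groups\<close>

text \<open>The additive group of the real line does not determine its topology: a Hamel basis makes
  it isomorphic to the plane, so it carries several Polish group topologies. Multiplication has to
  be brought in, and squares then bring in the order. In an unknown topology the closed sets at hand
  are the solution sets of group equations, so every subgroup is cut out by commuting with chosen
  elements. The translation part \<open>y\<close> is the stubborn coordinate. With -1 in
  \<open>S\<close>, the commutator of an element with -1 would be the translation by
  \<open>2y\<close> and settle the matter. For odd n, however, the centre of SL(n) is trivial, so a
  noncentral diagonal matrix of determinant 1 must serve, and elimination moves an element into the
  matrices that commute with it. Elimination needs a nonzero pivot; this confines the argument to a
  neighbourhood of the identity, from which left translation carries it elsewhere.\<close>

text \<open>Completeness is repackaged so that later arguments speak of open sets only:
  \<open>small n\<close> stands for lying in a closed ball of radius \<open>1 / (n + 1)\<close>, and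
  the second property is Cantor's intersection theorem, with the nested sets shrinking into every
  neighbourhood of the limit.\<close>

lemma complete_shrinking_neighbourhoods:
  assumes "completely_metrizable_space T"
  obtains small :: "nat \<Rightarrow> 'a set \<Rightarrow> bool" where
    "\<And>n q Q. openin T Q \<Longrightarrow> q \<in> Q \<Longrightarrow>
       \<exists>Q'. openin T Q' \<and> q \<in> Q' \<and> T closure_of Q' \<subseteq> Q \<and> small n Q'"
    "\<And>Q. (\<And>n. openin T (Q n)) \<Longrightarrow> (\<And>n. Q n \<noteq> {}) \<Longrightarrow> (\<And>n. T closure_of Q (Suc n) \<subseteq> Q n)
       \<Longrightarrow> (\<And>n. small n (Q (Suc n))) \<Longrightarrow>
       \<exists>q. (\<forall>n. q \<in> Q n) \<and> (\<forall>A. openin T A \<longrightarrow> q \<in> A \<longrightarrow> (\<exists>n. \<forall>m\<ge>n. Q m \<subseteq> A))"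
proof -
  obtain M d where "Metric_space M d" and comp: "Metric_space.mcomplete M d"
    and T: "T = Metric_space.mtopology M d"
    using assms completely_metrizable_space_def by blast
  then interpret Metric_space M d by blast
  define small where "small n Q \<longleftrightarrow> (\<exists>a\<in>M. Q \<subseteq> mcball a (inverse (Suc n)))" for n Q
  show thesis
  proof (rule that[of small])
    fix n q Q assume Q: "openin T Q" "q \<in> Q"
    then obtain e where e: "e > 0" "mball q e \<subseteq> Q" and qM: "q \<in> M"
      unfolding T openin_mtopology by blast
    define r where "r = min (e/2) (inverse (Suc n))"
    have r: "r > 0" "r < e" "r \<le> inverse (Suc n)"
      using e unfolding r_def by auto
    have "mtopology closure_of mball q r \<subseteq> mcball q r"
      by (intro closure_of_minimal mball_subset_mcball closedin_mcball)
    also have "\<dots> \<subseteq> mball q e"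
      using r by (intro mcball_subset_mball_concentric) auto
    finally have "T closure_of mball q r \<subseteq> Q" using e T by blast
    moreover have "mball q r \<subseteq> mcball q (inverse (Suc n))"
      using mball_subset_mcball mcball_subset_concentric r by (meson subset_trans)
    ultimately show "\<exists>Q'. openin T Q' \<and> q \<in> Q' \<and> T closure_of Q' \<subseteq> Q \<and> small n Q'"
      using r qM unfolding T small_def
      by (intro exI[of _ "mball q r"]) auto
  next
    fix Q assume op: "\<And>n. openin T (Q n)" and ne: "\<And>n. Q n \<noteq> {}"
      and cl: "\<And>n. T closure_of Q (Suc n) \<subseteq> Q n" and sm: "\<And>n. small n (Q (Suc n))"
    have QM: "Q n \<subseteq> M" for n using op[of n] openin_subset T by fastforce
    have sub: "Q n \<subseteq> T closure_of Q n" for n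
      using QM T by (simp add: closure_of_subset)
    have dec: "decseq Q" unfolding decseq_Suc_iff using cl sub by blast
    define C where "C n = T closure_of Q (Suc n)" for n
    have "\<Inter> (range C) \<noteq> {}"
    proof (rule comp[unfolded mcomplete_nest, rule_format], intro conjI allI impI)
      fix n show "closedin mtopology (C n)" by (simp add: C_def T)
      show "C n \<noteq> {}" using ne sub C_def by blast
    next
      show "decseq C" unfolding decseq_Suc_iff C_def using cl sub by blast
    next
      fix e :: real assume "e > 0"
      then obtain n where n: "inverse (real (Suc n)) < e" using reals_Archimedean by blast
      obtain a where "Q (Suc n) \<subseteq> mcball a (inverse (Suc n))" using sm small_def by blast
      then have "C n \<subseteq> mcball a (inverse (Suc n))"
        unfolding C_def T by (intro closure_of_minimal closedin_mcball)
      also have "\<dots> \<subseteq> mcball a e" using n by (intro mcball_subset_concentric) auto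
      finally show "\<exists>n a. C n \<subseteq> mcball a e" by blast
    qed
    then obtain q where "\<And>n. q \<in> C n" by blast
    then have q: "q \<in> Q n" for n using cl C_def by blast
    moreover have "\<exists>n. \<forall>m\<ge>n. Q m \<subseteq> A" if A: "openin T A" "q \<in> A" for A
    proof -
      obtain e where e: "e > 0" "mball q e \<subseteq> A"
        using A unfolding T openin_mtopology by blast
      have "e/2 > 0" using e by simp
      then obtain n where n: "inverse (real (Suc n)) < e/2" using reals_Archimedean by blast
      obtain a where a: "Q (Suc n) \<subseteq> mcball a (inverse (Suc n))" using sm small_def by blast
      have "Q (Suc n) \<subseteq> mball q e"
      proof
        fix z assume z: "z \<in> Q (Suc n)"
        have "d a z \<le> inverse (Suc n)" "d a q \<le> inverse (Suc n)" "a \<in> M" "z \<in> M" "q \<in> M"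
          using a z q[of "Suc n"] by (auto simp: in_mcball subset_iff)
        then have "d q z < e" using n triangle[of q a z] commute[of a q] by linarith
        then show "z \<in> mball q e" using \<open>z \<in> M\<close> \<open>q \<in> M\<close> by simp
      qed
      then show ?thesis using e dec unfolding decseq_def by (meson subset_trans)
    qed
    ultimately show "\<exists>q. (\<forall>n. q \<in> Q n) \<and> (\<forall>A. openin T A \<longrightarrow> q \<in> A \<longrightarrow> (\<exists>n. \<forall>m\<ge>n. Q m \<subseteq> A))"
      by blast
  qed
qed

lemma topological_groupD:
  assumes "topological_group G T"
  shows "group G" "topspace T = carrier G"
    "continuous_map (prod_topology T T) T (\<lambda>(x, y). x \<otimes>\<^bsub>G\<^esub> y)"
    "continuous_map T T (\<lambda>x. inv\<^bsub>G\<^esub> x)"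
  using assms by (auto simp: topological_group_def)

lemma polish_groupD:
  assumes "polish_group G T"
  shows "topological_group G T" "separable_space T" "completely_metrizable_space T"
  using assms by (auto simp: polish_group_def)

lemma Hausdorff_polish_group:
  "polish_group G T \<Longrightarrow> Hausdorff_space T"
  by (simp add: completely_metrizable_imp_metrizable_space metrizable_imp_Hausdorff_space polish_groupD(3))

lemma continuous_map_group_mult:
  assumes "topological_group G T" "continuous_map X T f" "continuous_map X T g"
  shows "continuous_map X T (\<lambda>x. f x \<otimes>\<^bsub>G\<^esub> g x)"
proof -
  have "continuous_map X (prod_topology T T) (\<lambda>x. (f x, g x))"
    using assms by (simp add: continuous_map_pairedI)
  from continuous_map_compose[OF this topological_groupD(3)[OF assms(1)]]
  show ?thesis by (simp add: o_def)
qed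

lemma continuous_map_group_inv:
  assumes "topological_group G T" "continuous_map X T f"
  shows "continuous_map X T (\<lambda>x. inv\<^bsub>G\<^esub> f x)"
  using continuous_map_compose[OF assms(2) topological_groupD(4)[OF assms(1)]] by (simp add: o_def)

lemma homeomorphic_map_left_translation:
  assumes "topological_group G T" "g \<in> carrier G"
  shows "homeomorphic_map T T (\<lambda>x. g \<otimes>\<^bsub>G\<^esub> x)"
proof -
  interpret group G using topological_groupD assms by blast
  have top: "topspace T = carrier G" using topological_groupD assms by blast
  have "homeomorphic_maps T T (\<lambda>x. g \<otimes>\<^bsub>G\<^esub> x) (\<lambda>x. inv\<^bsub>G\<^esub> g \<otimes>\<^bsub>G\<^esub> x)"
    unfolding homeomorphic_maps_def using assms
    by (auto simp: top m_assoc[symmetric] intro!: continuous_map_group_mult)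
  then show ?thesis using homeomorphic_map_maps by blast
qed

lemma homeomorphic_map_interior_closure:
  assumes "homeomorphic_map X Y f" "S \<subseteq> topspace X"
  shows "Y interior_of (Y closure_of (f ` S)) = f ` (X interior_of (X closure_of S))"
proof -
  have "X closure_of S \<subseteq> topspace X" by (rule closure_of_subset_topspace)
  then show ?thesis
    using homeomorphic_map_closure_of[OF assms] homeomorphic_map_interior_of[OF assms(1)] by metis
qed

lemma homeomorphic_map_openin_image:
  "homeomorphic_map X Y f \<Longrightarrow> openin X U \<Longrightarrow> openin Y (f ` U)"
  using homeomorphic_map_openness openin_subset by blast

lemma openin_prod_topology_square:
  assumes "openin (prod_topology T T) U" "(a, a) \<in> U"
  obtains W where "openin T W" "a \<in> W" "W \<times> W \<subseteq> U"
proof -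
  obtain A B where "openin T A" "openin T B" "a \<in> A" "a \<in> B" "A \<times> B \<subseteq> U"
    using assms(1)[unfolded openin_prod_topology_alt, rule_format, OF assms(2)] by metis
  then show thesis by (intro that[of "A \<inter> B"]) auto
qed

locale polish_action =
  fixes G :: "('g, 'b) monoid_scheme" (structure) and T :: "'g topology" and X :: "'x topology"
    and act :: "'g \<Rightarrow> 'x \<Rightarrow> 'x"
  assumes polish: "polish_group G T"
    and complete_space: "completely_metrizable_space X"
    and continuous_act: "continuous_map (prod_topology T X) X (\<lambda>(g, x). act g x)"
    and act_mult: "g \<in> carrier G \<Longrightarrow> h \<in> carrier G \<Longrightarrow> x \<in> topspace X
      \<Longrightarrow> act (g \<otimes>\<^bsub>G\<^esub> h) x = act g (act h x)"
    and act_one: "x \<in> topspace X \<Longrightarrow> act \<one>\<^bsub>G\<^esub> x = x"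
begin

sublocale group G
  using polish polish_groupD(1) topological_groupD(1) by blast

lemma topgroup: "topological_group G T"
  using polish polish_groupD(1) by blast

lemma top: "topspace T = carrier G"
  using topgroup topological_groupD by blast

lemma continuous_act2:
  assumes "continuous_map Y T f" "continuous_map Y X g"
  shows "continuous_map Y X (\<lambda>y. act (f y) (g y))"
proof -
  have "continuous_map Y (prod_topology T X) (\<lambda>y. (f y, g y))"
    using assms by (simp add: continuous_map_pairedI)
  from continuous_map_compose[OF this continuous_act]
  show ?thesis by (simp add: o_def)
qed

lemma act_closed: "g \<in> carrier G \<Longrightarrow> x \<in> topspace X \<Longrightarrow> act g x \<in> topspace X"
  using continuous_map_funspace[OF continuous_act] by (force simp: top Pi_iff)

lemma homeomorphic_map_act:
  assumes "g \<in> carrier G"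
  shows "homeomorphic_map X X (act g)"
proof -
  have "homeomorphic_maps X X (act g) (act (inv g))"
    unfolding homeomorphic_maps_def using assms act_mult[of g "inv g"] act_mult[of "inv g" g]
    by (auto simp: top act_one intro!: continuous_act2)
  then show ?thesis using homeomorphic_map_maps by blast
qed

lemma continuous_orbit_map: "x \<in> topspace X \<Longrightarrow> continuous_map T X (\<lambda>g. act g x)"
  by (intro continuous_act2) (auto simp: top)

text \<open>For given \<open>g\<close>, the elements \<open>x\<close> with
  \<open>inv x \<otimes> g\<close> in \<open>W\<close> form an open set, nonempty because it
  contains \<open>g \<otimes> inv w\<close> for \<open>w\<close> in \<open>W\<close>; hence it meets
  the countable dense set.\<close>

lemma countable_translates:
  assumes "openin T W" "W \<noteq> {}"
  shows "\<exists>D. countable D \<and> D \<subseteq> carrier G \<and> carrier G = (\<Union>d\<in>D. (\<lambda>w. d \<otimes> w) ` W)"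
proof -
  obtain D where D: "countable D" "D \<subseteq> carrier G" "T closure_of D = carrier G"
    using polish_groupD(2)[OF polish] unfolding separable_space_def top by blast
  have WG: "W \<subseteq> carrier G" using assms openin_subset top by blast
  have "g \<in> (\<Union>d\<in>D. (\<lambda>w. d \<otimes> w) ` W)" if g: "g \<in> carrier G" for g
  proof -
    obtain w where w: "w \<in> W" using assms by blast
    have op: "openin T {x \<in> topspace T. inv x \<otimes> g \<in> W}"
      using assms(1) g
      by (intro openin_continuous_map_preimage[OF _ assms(1)] continuous_map_group_mult[OF topgroup]
          continuous_map_group_inv[OF topgroup]) (auto simp: top)
    have "g \<otimes> inv w \<in> {x \<in> topspace T. inv x \<otimes> g \<in> W}"
      using w WG g by (auto simp: top inv_mult_group m_assoc)
    moreover have "g \<otimes> inv w \<in> T closure_of D" using D g w WG by auto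
    ultimately have "{x \<in> topspace T. inv x \<otimes> g \<in> W} \<inter> T closure_of D \<noteq> {}" by blast
    then have "{x \<in> topspace T. inv x \<otimes> g \<in> W} \<inter> D \<noteq> {}"
      using openin_Int_closure_of_eq_empty[OF op] by simp
    then obtain d where "d \<in> D" "inv d \<otimes> g \<in> W" by blast
    moreover have "g = d \<otimes> (inv d \<otimes> g)"
      using g D \<open>d \<in> D\<close> m_assoc[symmetric, of d "inv d" g] by auto
    ultimately show ?thesis by blast
  qed
  then show ?thesis using D WG by (intro exI[of _ D]) auto
qed

text \<open>Baire category: countably many homeomorphic copies of \<open>W x\<close> cover the space, so the closure
  of \<open>W x\<close> has interior, which a translation inside \<open>U\<close> moves onto \<open>x\<close>.\<close>

lemma nearly_open:
  assumes x: "x \<in> topspace X" and h: "\<And>i::nat. homeomorphic_map X X (h i)"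
    and cover: "topspace X \<subseteq> (\<Union>i. h i ` ((\<lambda>g. act g x) ` carrier G))"
    and Q: "openin T Q" "q \<in> Q"
  shows "act q x \<in> X interior_of (X closure_of ((\<lambda>g. act g x) ` Q))"
proof -
  have qG: "q \<in> carrier G" and QG: "Q \<subseteq> carrier G" using Q openin_subset top by blast+
  \<comment> \<open>Continuity at the identity yields \<open>W\<close> with
    \<open>q \<otimes> (inv a \<otimes> b)\<close> in \<open>Q\<close> for all \<open>a\<close>,
    \<open>b\<close> in \<open>W\<close>, the room that the final translation needs.\<close>
  have "openin (prod_topology T T) {p \<in> topspace (prod_topology T T). (\<lambda>p. q \<otimes> (inv (fst p) \<otimes> snd p)) p \<in> Q}"
    using qG by (intro openin_continuous_map_preimage[OF _ Q(1)] continuous_map_group_mult[OF topgroup]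
        continuous_map_group_inv[OF topgroup]) (auto simp: top continuous_map_fst continuous_map_snd)
  moreover have "(\<one>, \<one>) \<in> {p \<in> topspace (prod_topology T T). (\<lambda>p. q \<otimes> (inv (fst p) \<otimes> snd p)) p \<in> Q}"
    using Q qG by (auto simp: top)
  ultimately obtain W where W: "openin T W" "\<one> \<in> W"
    and WW: "W \<times> W \<subseteq> {p \<in> topspace (prod_topology T T). (\<lambda>p. q \<otimes> (inv (fst p) \<otimes> snd p)) p \<in> Q}"
    by (rule openin_prod_topology_square)
  have WQ: "q \<otimes> (inv a \<otimes> b) \<in> Q" if "a \<in> W" "b \<in> W" for a b
    using WW that by auto
  have WG: "W \<subseteq> carrier G" using W openin_subset top by blast
  let ?o = "\<lambda>S. (\<lambda>g. act g x) ` S"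
  obtain D where D: "countable D" "D \<subseteq> carrier G" "carrier G = (\<Union>d\<in>D. (\<lambda>w. d \<otimes> w) ` W)"
    using countable_translates[OF W(1)] W(2) by (metis empty_iff)
  have WX: "?o W \<subseteq> topspace X" using WG x act_closed by blast
  have actWX: "act d ` ?o W \<subseteq> topspace X" if "d \<in> D" for d
    using D that WX act_closed by blast
  have "X interior_of (X closure_of (?o W)) \<noteq> {}"
  proof
    assume empty: "X interior_of (X closure_of (?o W)) = {}"
    let ?F = "\<lambda>(i,d). X closure_of (h i ` act d ` ?o W)"
    let ?GG = "?F ` (UNIV \<times> D)"
    have "X interior_of \<Union>?GG = {}"
    proof (rule Baire_category_alt)
      show "countable ?GG" using D by auto
      fix S assume "S \<in> ?GG"
      then obtain i d where id: "d \<in> D" "S = X closure_of (h i ` act d ` ?o W)" by auto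
      have "X interior_of S = h i ` act d ` (X interior_of (X closure_of (?o W)))"
        using id D homeomorphic_map_interior_closure[OF h actWX]
          homeomorphic_map_interior_closure[OF homeomorphic_map_act WX] by (metis subsetD)
      then show "closedin X S \<and> X interior_of S = {}" using id empty by auto
    qed (use complete_space in auto)
    moreover have "topspace X \<subseteq> \<Union>?GG"
    proof
      fix y assume "y \<in> topspace X"
      then obtain i g where ig: "g \<in> carrier G" "y = h i (act g x)" using cover by blast
      then obtain d w where dw: "d \<in> D" "w \<in> W" "g = d \<otimes> w" using D by blast
      then have "act g x = act d (act w x)" using act_mult D WG x by blast
      then have "y \<in> h i ` act d ` ?o W" using ig dw by blast
      moreover have "h i ` act d ` ?o W \<subseteq> X closure_of (h i ` act d ` ?o W)"
        using actWX[OF dw(1)] homeomorphic_imp_surjective_map[OF h, of i]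
        by (intro closure_of_subset) blast
      ultimately show "y \<in> \<Union>?GG" using dw by blast
    qed
    ultimately have "topspace X = {}"
      by (metis interior_of_mono interior_of_topspace subset_empty)
    then show False using x by blast
  qed
  then have "X interior_of (X closure_of (?o W)) \<inter> X closure_of (?o W) \<noteq> {}"
    using interior_of_subset[of X "X closure_of (?o W)"] by (simp add: Int_absorb2)
  then have "X interior_of (X closure_of (?o W)) \<inter> ?o W \<noteq> {}"
    using openin_Int_closure_of_eq_empty[OF openin_interior_of] by metis
  then obtain w where w: "w \<in> W" "act w x \<in> X interior_of (X closure_of (?o W))"
    by blast
  \<comment> \<open>This element takes \<open>act w x\<close> to \<open>act q x\<close>, and by the
    choice of \<open>W\<close> it carries \<open>?o W\<close> into \<open>?o Q\<close>.\<close>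
  let ?g = "q \<otimes> inv w"
  have wG: "w \<in> carrier G" using w WG by blast
  have g: "?g \<in> carrier G" using wG qG by auto
  have "act q x = act ?g (act w x)"
    using wG qG x act_mult[symmetric, of ?g w x] by (simp add: m_assoc)
  also have "\<dots> \<in> act ?g ` (X interior_of (X closure_of (?o W)))" using w by blast
  also have "\<dots> = X interior_of (X closure_of (act ?g ` ?o W))"
    using homeomorphic_map_interior_closure[OF homeomorphic_map_act[OF g] WX] by simp
  also have "\<dots> \<subseteq> X interior_of (X closure_of (?o Q))"
  proof (intro interior_of_mono closure_of_mono)
    show "act ?g ` ?o W \<subseteq> ?o Q"
    proof clarify
      fix b assume b: "b \<in> W"
      then have "act ?g (act b x) = act (q \<otimes> (inv w \<otimes> b)) x"
        using act_mult[symmetric, OF g, of b x] WG x wG qG by (auto simp: m_assoc)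
      then show "act ?g (act b x) \<in> ?o Q" using WQ[OF w(1) b] by auto
    qed
  qed
  finally show ?thesis .
qed

text \<open>The alternating argument of Effros: if \<open>y\<close> lies in the interior of the closure of \<open>U x\<close>,
  nested neighbourhoods \<open>Q\<^sub>n\<close> and \<open>R\<^sub>n\<close> in \<open>U\<close> are chosen such that \<open>Q\<^sub>n x\<close> and \<open>R\<^sub>n y\<close> approximate each
  other; their limits \<open>q\<close> and \<open>r\<close> satisfy \<open>q x = r y\<close>.\<close>

lemma effros_meet:
  assumes near: "\<And>x Q q. x \<in> topspace X \<Longrightarrow> openin T Q \<Longrightarrow> q \<in> Q \<Longrightarrow>
      act q x \<in> X interior_of (X closure_of ((\<lambda>g. act g x) ` Q))"
    and x: "x \<in> topspace X" and U: "openin T U" "\<one> \<in> U"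
    and y: "y \<in> X interior_of (X closure_of ((\<lambda>g. act g x) ` U))"
  shows "\<exists>q\<in>U. \<exists>r\<in>U. act q x = act r y"
proof -
  have yX: "y \<in> topspace X"
    by (meson in_mono interior_of_subset_topspace y)
  let ?o = "\<lambda>x S. (\<lambda>g. act g x) ` S"
  let ?ic = "\<lambda>x S. X interior_of (X closure_of (?o x S))"
  obtain small where
    small1: "\<And>n q Q. openin T Q \<Longrightarrow> q \<in> Q \<Longrightarrow>
       \<exists>Q'. openin T Q' \<and> q \<in> Q' \<and> T closure_of Q' \<subseteq> Q \<and> small n Q'"
   and small2: "\<And>Q. (\<And>n. openin T (Q n)) \<Longrightarrow> (\<And>n. Q n \<noteq> {}) \<Longrightarrow> (\<And>n. T closure_of Q (Suc n) \<subseteq> Q n)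
       \<Longrightarrow> (\<And>n. small n (Q (Suc n))) \<Longrightarrow>
       \<exists>q. (\<forall>n. q \<in> Q n) \<and> (\<forall>A. openin T A \<longrightarrow> q \<in> A \<longrightarrow> (\<exists>n. \<forall>m\<ge>n. Q m \<subseteq> A))"
    using complete_shrinking_neighbourhoods[OF polish_groupD(3)[OF polish]] by metis
  have shrink: "\<exists>Q'. openin T Q' \<and> q \<in> Q' \<and> T closure_of Q' \<subseteq> Q \<and> small n Q' \<and> ?o z Q' \<subseteq> V"
    if "openin T Q" "q \<in> Q" "z \<in> topspace X" "openin X V" "act q z \<in> V" for Q q z V n
  proof -
    have "openin T {g \<in> topspace T. act g z \<in> V}"
      using continuous_orbit_map that openin_continuous_map_preimage by blast
    then have "openin T (Q \<inter> {g \<in> topspace T. act g z \<in> V})" using that by blast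
    moreover have "q \<in> Q \<inter> {g \<in> topspace T. act g z \<in> V}" using that openin_subset by blast
    ultimately obtain Q' where Q': "openin T Q'" "q \<in> Q'"
      "T closure_of Q' \<subseteq> Q \<inter> {g \<in> topspace T. act g z \<in> V}" "small n Q'"
      using small1[of "Q \<inter> {g \<in> topspace T. act g z \<in> V}" q n] by blast
    moreover have "Q' \<subseteq> T closure_of Q'" using Q' by (simp add: closure_of_subset openin_subset)
    ultimately show ?thesis by (intro exI[of _ Q']) auto
  qed
  \<comment> \<open>\<open>P\<close> is the invariant of the pairs of neighbourhoods. The last
    clause of \<open>S\<close> puts the next piece of the orbit of \<open>x\<close> into the closure
    of the current piece of the orbit of \<open>y\<close>; this is what makes the two limits
    agree.\<close>
  define P where "P p \<longleftrightarrow> openin T (fst p) \<and> openin T (snd p) \<and> ?o x (fst p) \<inter> ?ic y (snd p) \<noteq> {}" for p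
  define S where "S n p p' \<longleftrightarrow> T closure_of (fst p') \<subseteq> fst p \<and> T closure_of (snd p') \<subseteq> snd p \<and>
    small n (fst p') \<and> small n (snd p') \<and> ?o x (fst p') \<subseteq> X closure_of (?o y (snd p))" for n p p'
  have meets: "A \<inter> B \<noteq> {}" if "openin X A" "z \<in> A" "z \<in> X interior_of (X closure_of B)" for A B z
  proof -
    have "z \<in> X closure_of B" using interior_of_subset[THEN subsetD, OF that(3)] .
    then show ?thesis using that(1,2) unfolding in_closure_of by blast
  qed
  have step: "\<exists>p'. P p' \<and> S n p p'" if p: "P p" for p n
  proof -
    obtain Q R where QR: "p = (Q, R)" by fastforce
    then obtain q where q: "q \<in> Q" "act q x \<in> ?ic y R" and op: "openin T Q" "openin T R"
      using p unfolding P_def by auto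
    then obtain Q' where Q': "openin T Q'" "q \<in> Q'" "T closure_of Q' \<subseteq> Q" "small n Q'"
      "?o x Q' \<subseteq> ?ic y R"
      using shrink[OF op(1) q(1) x openin_interior_of q(2)] by metis
    have "?ic x Q' \<inter> ?o y R \<noteq> {}"
      using meets[OF openin_interior_of near[OF x Q'(1,2)] q(2)] by blast
    then obtain r where r: "r \<in> R" "act r y \<in> ?ic x Q'" by auto
    then obtain R' where R': "openin T R'" "r \<in> R'" "T closure_of R' \<subseteq> R" "small n R'"
      "?o y R' \<subseteq> ?ic x Q'"
      using shrink[OF op(2) r(1) yX openin_interior_of r(2)] by metis
    have "?ic y R' \<inter> ?o x Q' \<noteq> {}"
      using meets[OF openin_interior_of near[OF yX R'(1,2)] r(2)] by blast
    then show ?thesis using Q' R' interior_of_subset[of X "X closure_of (?o y R)"]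
      by (intro exI[of _ "(Q', R')"]) (auto simp: P_def S_def QR)
  qed
  have "?ic y U \<inter> ?o x U \<noteq> {}"
    using meets[OF openin_interior_of near[OF yX U]] y act_one[OF yX] by auto
  then have init: "P (U, U)" using U by (auto simp: P_def)
  \<comment> \<open>The clause for \<open>n = 0\<close> pins the start at \<open>(U, U)\<close>, so
    that both limits lie in \<open>U\<close>.\<close>
  obtain F where F: "F 0 = (U, U)" "\<And>n. P (F n)" "\<And>n. S n (F n) (F (Suc n))"
    using dependent_nat_choice[of "\<lambda>n p. P p \<and> (n = 0 \<longrightarrow> p = (U, U))" S] init step by (metis nat.distinct(1))
  define Q where "Q n = fst (F n)" for n
  define R where "R n = snd (F n)" for n
  have Q0: "Q 0 = U" "R 0 = U" using F(1) by (auto simp: Q_def R_def)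
  have QR: "openin T (Q n)" "openin T (R n)" "Q n \<noteq> {}" "R n \<noteq> {}" for n
    using F(2)[of n] by (auto simp: P_def Q_def R_def)
  have SS: "T closure_of Q (Suc n) \<subseteq> Q n" "T closure_of R (Suc n) \<subseteq> R n" "small n (Q (Suc n))"
    "small n (R (Suc n))" "?o x (Q (Suc n)) \<subseteq> X closure_of (?o y (R n))" for n
    using F(3)[of n] by (auto simp: S_def Q_def R_def)
  obtain q where q: "\<And>n. q \<in> Q n" "\<And>A. openin T A \<Longrightarrow> q \<in> A \<Longrightarrow> \<exists>n. \<forall>m\<ge>n. Q m \<subseteq> A"
    using small2[of Q] QR SS by metis
  obtain r where r: "\<And>n. r \<in> R n" "\<And>A. openin T A \<Longrightarrow> r \<in> A \<Longrightarrow> \<exists>n. \<forall>m\<ge>n. R m \<subseteq> A"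
    using small2[of R] QR SS by metis
  have qU: "q \<in> U" and rU: "r \<in> U" using q(1)[of 0] r(1)[of 0] Q0 by auto
  have "act q x = act r y"
  proof (rule ccontr)
    assume ne: "act q x \<noteq> act r y"
    have "Hausdorff_space X"
      using complete_space completely_metrizable_imp_metrizable_space metrizable_imp_Hausdorff_space by blast
    moreover have "act q x \<in> topspace X" "act r y \<in> topspace X"
      using qU rU U x yX act_closed openin_subset top by blast+
    ultimately obtain A B where AB: "openin X A" "openin X B" "act q x \<in> A" "act r y \<in> B" "disjnt A B"
      using ne unfolding Hausdorff_space_def by metis
    have oA: "openin T {g \<in> topspace T. act g x \<in> A}" and oB: "openin T {g \<in> topspace T. act g y \<in> B}"
      using continuous_orbit_map x yX AB openin_continuous_map_preimage by blast+
    have qA: "q \<in> {g \<in> topspace T. act g x \<in> A}" and rB: "r \<in> {g \<in> topspace T. act g y \<in> B}"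
      using AB qU rU U openin_subset by blast+
    obtain m where m: "\<forall>k\<ge>m. Q k \<subseteq> {g \<in> topspace T. act g x \<in> A}" using q(2)[OF oA qA] ..
    obtain n where n: "\<forall>k\<ge>n. R k \<subseteq> {g \<in> topspace T. act g y \<in> B}" using r(2)[OF oB rB] ..
    define k where "k = max m n"
    have "act q x \<in> X closure_of (?o y (R k))" using SS(5)[of k] q(1)[of "Suc k"] by blast
    then have "A \<inter> X closure_of (?o y (R k)) \<noteq> {}" using AB(3) by blast
    then have "A \<inter> ?o y (R k) \<noteq> {}" using openin_Int_closure_of_eq_empty[OF AB(1)] by metis
    moreover have "?o y (R k) \<subseteq> B" using n[rule_format, of k] by (auto simp: k_def)
    ultimately have "A \<inter> B \<noteq> {}" by blast
    then show False using AB by (simp add: disjnt_def)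
  qed
  then show ?thesis using qU rU by blast
qed

text \<open>From \<open>act q x = act r y\<close> follows
  \<open>y = act (inv r \<otimes> q) x\<close>, so it suffices to choose \<open>W\<close> with
  \<open>inv a \<otimes> b\<close> in \<open>U\<close> for \<open>a\<close>, \<open>b\<close> in
  \<open>W\<close>. The maps \<open>h i\<close> admit actions that are not transitive: for Baire
  category it is enough that countably many homeomorphic copies of each orbit cover the
  space.\<close>

lemma orbit_map_open:
  assumes h: "\<And>i::nat. homeomorphic_map X X (h i)"
    and cover: "\<And>x. x \<in> topspace X \<Longrightarrow> topspace X \<subseteq> (\<Union>i. h i ` ((\<lambda>g. act g x) ` carrier G))"
    and x: "x \<in> topspace X" and U: "openin T U" "\<one> \<in> U"
  shows "\<exists>V. openin X V \<and> x \<in> V \<and> V \<subseteq> (\<lambda>g. act g x) ` U"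
proof -
  have near: "act q x \<in> X interior_of (X closure_of ((\<lambda>g. act g x) ` Q))"
    if "x \<in> topspace X" "openin T Q" "q \<in> Q" for x Q q
    using nearly_open[OF that(1) h cover[OF that(1)] that(2,3)] .
  have "openin (prod_topology T T) {p \<in> topspace (prod_topology T T). (\<lambda>p. inv (fst p) \<otimes> snd p) p \<in> U}"
    by (intro openin_continuous_map_preimage[OF _ U(1)] continuous_map_group_mult[OF topgroup]
        continuous_map_group_inv[OF topgroup]) (auto simp: top continuous_map_fst continuous_map_snd)
  moreover have "(\<one>, \<one>) \<in> {p \<in> topspace (prod_topology T T). (\<lambda>p. inv (fst p) \<otimes> snd p) p \<in> U}"
    using U by (auto simp: top)
  ultimately obtain W where W: "openin T W" "\<one> \<in> W"
    and WW: "W \<times> W \<subseteq> {p \<in> topspace (prod_topology T T). (\<lambda>p. inv (fst p) \<otimes> snd p) p \<in> U}"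
    by (rule openin_prod_topology_square)
  have WU: "inv a \<otimes> b \<in> U" if "a \<in> W" "b \<in> W" for a b
    using WW that by auto
  have WG: "W \<subseteq> carrier G" using W openin_subset top by blast
  let ?V = "X interior_of (X closure_of ((\<lambda>g. act g x) ` W))"
  have "?V \<subseteq> (\<lambda>g. act g x) ` U"
  proof
    fix y assume y: "y \<in> ?V"
    have yX: "y \<in> topspace X" by (meson in_mono interior_of_subset_topspace y)
    obtain q r where qr: "q \<in> W" "r \<in> W" "act q x = act r y"
      using effros_meet[OF near x W y] by blast
    then have qrG: "q \<in> carrier G" "r \<in> carrier G" using WG by auto
    have "act (inv r \<otimes> q) x = act (inv r) (act r y)"
      using act_mult[of "inv r" q x] x qrG qr by simp
    also have "\<dots> = y" using act_mult[of "inv r" r y] qrG yX act_one by simp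
    finally show "y \<in> (\<lambda>g. act g x) ` U" using WU qr by blast
  qed
  moreover have "x \<in> ?V" using near[OF x W] act_one[OF x] by simp
  ultimately show ?thesis using openin_interior_of by blast
qed

end

section \<open>The open mapping theorem for Polish groups\<close>

text \<open>The group with the finer topology \<open>T1\<close> acts on the space \<open>T2\<close>
  by left multiplication. The action is transitive, so the covering maps can all be the identity,
  and openness of the orbit map of \<one> says that \<open>T1\<close>-neighbourhoods of \<one> are
  \<open>T2\<close>-neighbourhoods.\<close>

lemma polish_group_topology_unique:
  fixes G (structure)
  assumes p1: "polish_group G T1" and p2: "polish_group G T2" and id: "continuous_map T1 T2 (\<lambda>x. x)"
  shows "T1 = T2"
proof -
  have tg1: "topological_group G T1" and tg2: "topological_group G T2"
    using p1 p2 polish_groupD by blast+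
  interpret group G using tg1 topological_groupD by blast
  have top12: "topspace T1 = carrier G" "topspace T2 = carrier G"
    using tg1 tg2 topological_groupD by blast+
  interpret polish_action G T1 T2 "\<lambda>g x. g \<otimes>\<^bsub>G\<^esub> x"
  proof
    show "continuous_map (prod_topology T1 T2) T2 (\<lambda>(g, x). g \<otimes> x)"
      unfolding case_prod_unfold
      by (rule continuous_map_group_mult[OF tg2])
        (use continuous_map_compose[OF continuous_map_fst id] in \<open>auto simp: o_def continuous_map_snd\<close>)
  qed (use p1 p2 polish_groupD m_assoc top12 in auto)
  have cover: "topspace T2 \<subseteq> (\<Union>i::nat. id ` ((\<lambda>g. g \<otimes> x) ` carrier G))" if "x \<in> topspace T2" for x
  proof
    fix y assume "y \<in> topspace T2"
    then have "y \<in> carrier G" "x \<in> carrier G" using that top12 by auto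
    then have "y = (y \<otimes> inv x) \<otimes> x" "y \<otimes> inv x \<in> carrier G" by (simp_all add: m_assoc)
    then show "y \<in> (\<Union>i::nat. id ` ((\<lambda>g. g \<otimes> x) ` carrier G))" by auto
  qed
  have nbhd: "\<exists>V. openin T2 V \<and> \<one> \<in> V \<and> V \<subseteq> U" if U: "openin T1 U" "\<one> \<in> U" for U
  proof -
    have "U \<subseteq> carrier G" using U openin_subset top12 by blast
    then have "(\<lambda>g. g \<otimes> \<one>) ` U = U" by (force simp: image_iff subset_iff)
    then show ?thesis
      using orbit_map_open[OF homeomorphic_map_id[THEN iffD2, OF refl] cover _ U, of \<one>] top12 by auto
  qed
  have "openin T2 U" if U: "openin T1 U" for U
  proof (subst openin_subopen, intro ballI)
    fix g assume g: "g \<in> U"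
    have UG: "U \<subseteq> carrier G" using U openin_subset top12 by blast
    then have gG: "g \<in> carrier G" using g by auto
    have "openin T1 ((\<lambda>x. inv g \<otimes> x) ` U)"
      using homeomorphic_map_openin_image[OF homeomorphic_map_left_translation[OF tg1] U] gG by auto
    moreover have "\<one> \<in> (\<lambda>x. inv g \<otimes> x) ` U" using g gG by (intro image_eqI[of _ _ g]) auto
    ultimately obtain V where V: "openin T2 V" "\<one> \<in> V" "V \<subseteq> (\<lambda>x. inv g \<otimes> x) ` U"
      using nbhd by blast
    have "openin T2 ((\<lambda>x. g \<otimes> x) ` V)"
      using homeomorphic_map_openin_image[OF homeomorphic_map_left_translation[OF tg2 gG] V(1)] .
    moreover have "g \<in> (\<lambda>x. g \<otimes> x) ` V" using V gG by (intro image_eqI[of _ _ \<one>]) auto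
    moreover have "(\<lambda>x. g \<otimes> x) ` V \<subseteq> U"
    proof clarify
      fix v assume "v \<in> V"
      then obtain u where u: "u \<in> U" "v = inv g \<otimes> u" using V by blast
      then have "g \<otimes> v = u" using gG UG m_assoc[symmetric, of g "inv g" u] by auto
      then show "g \<otimes> v \<in> U" using u by simp
    qed
    ultimately show "\<exists>S. openin T2 S \<and> g \<in> S \<and> S \<subseteq> U" by blast
  qed
  moreover have "openin T1 U" if "openin T2 U" for U
  proof -
    have "{x \<in> topspace T1. x \<in> U} = U" using that openin_subset top12 by blast
    then show ?thesis using openin_continuous_map_preimage[OF id that] by simp
  qed
  ultimately show ?thesis by (auto simp: topology_eq)
qed

section \<open>Closed subgroups and additive groups\<close>

text \<open>Second countability is the form of separability that passes to subspaces, and so to the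
  closed subgroups below.\<close>

lemma separable_metrizable_imp_second_countable:
  assumes "metrizable_space X" "separable_space X"
  shows "second_countable X"
proof -
  obtain M d where "Metric_space M d" and X: "X = Metric_space.mtopology M d"
    using assms unfolding metrizable_space_def by blast
  then interpret Metric_space M d by blast
  obtain D where D: "countable D" "D \<subseteq> M" "mtopology closure_of D = M"
    using assms(2) unfolding separable_space_def X topspace_mtopology by blast
  define B where "B = (\<lambda>(c, n). mball c (inverse (Suc n))) ` (D \<times> (UNIV :: nat set))"
  have "\<exists>V\<in>B. x \<in> V \<and> V \<subseteq> U" if U: "openin mtopology U" "x \<in> U" for U x
  proof -
    obtain e where e: "e > 0" "mball x e \<subseteq> U" and x: "x \<in> M"
      using U unfolding openin_mtopology by blast
    have "e/2 > 0" using e by simp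
    then obtain n where n: "inverse (real (Suc n)) < e/2" using reals_Archimedean by blast
    have "x \<in> mtopology closure_of D" using D x by simp
    then have "\<exists>c\<in>D. c \<in> mball x (inverse (Suc n))"
      unfolding metric_closure_of by simp
    then obtain c where c: "c \<in> D" "c \<in> M" "d x c < inverse (Suc n)" by auto
    have "mball c (inverse (Suc n)) \<subseteq> mball x e"
    proof
      fix z assume "z \<in> mball c (inverse (Suc n))"
      then have "z \<in> M" "d c z < inverse (Suc n)" by auto
      then show "z \<in> mball x e" using triangle[of x c z] x c n by simp
    qed
    moreover have "x \<in> mball c (inverse (Suc n))" using c x by (simp add: commute)
    ultimately show ?thesis using c e unfolding B_def by blast
  qed
  moreover have "countable B" "\<And>V. V \<in> B \<Longrightarrow> openin mtopology V"
    using D unfolding B_def by auto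
  ultimately show ?thesis unfolding second_countable_def X by blast
qed

lemma polish_group_second_countable: "polish_group G T \<Longrightarrow> second_countable T"
  by (simp add: completely_metrizable_imp_metrizable_space polish_groupD
      separable_metrizable_imp_second_countable)

lemma second_countable_prod_topology:
  assumes "second_countable X" "second_countable Y"
  shows "second_countable (prod_topology X Y)"
proof -
  obtain A where A: "countable A" "\<And>V. V \<in> A \<Longrightarrow> openin X V"
    "\<And>U x. openin X U \<Longrightarrow> x \<in> U \<Longrightarrow> \<exists>V\<in>A. x \<in> V \<and> V \<subseteq> U"
    using assms(1) unfolding second_countable_def by metis
  obtain B where B: "countable B" "\<And>V. V \<in> B \<Longrightarrow> openin Y V"
    "\<And>U x. openin Y U \<Longrightarrow> x \<in> U \<Longrightarrow> \<exists>V\<in>B. x \<in> V \<and> V \<subseteq> U"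
    using assms(2) unfolding second_countable_def by metis
  let ?C = "(\<lambda>(a, b). a \<times> b) ` (A \<times> B)"
  have "\<exists>V\<in>?C. p \<in> V \<and> V \<subseteq> U" if U: "openin (prod_topology X Y) U" "p \<in> U" for U p
  proof -
    obtain x y where p: "p = (x, y)" by fastforce
    obtain V W where VW: "openin X V" "openin Y W" "x \<in> V" "y \<in> W" "V \<times> W \<subseteq> U"
      using U(1)[unfolded openin_prod_topology_alt, rule_format] U(2) p by metis
    obtain V' where V': "V' \<in> A" "x \<in> V'" "V' \<subseteq> V" using A(3) VW by metis
    obtain W' where W': "W' \<in> B" "y \<in> W'" "W' \<subseteq> W" using B(3) VW by metis
    have "V' \<times> W' \<in> ?C" "p \<in> V' \<times> W'" "V' \<times> W' \<subseteq> U" using V' W' VW p by auto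
    then show ?thesis by blast
  qed
  moreover have "countable ?C" using A B by auto
  moreover have "\<forall>V\<in>?C. openin (prod_topology X Y) V"
    using A(2) B(2) by (auto simp: openin_prod_Times_iff)
  ultimately show ?thesis unfolding second_countable_def by (intro exI[of _ ?C]) simp
qed

lemma second_countable_euclidean: "second_countable (euclidean :: 'a::second_countable_topology topology)"
proof -
  obtain B :: "'a set set" where "countable B" "topological_basis B"
    using ex_countable_basis by blast
  then show ?thesis unfolding second_countable_def topological_basis_def
    by (intro exI[of _ B]) (force simp: subset_eq)
qed

lemma topspace_pullback_hom:
  assumes "topspace T = carrier G" "f \<in> hom H G"
  shows "topspace (pullback_topology (carrier H) f T) = carrier H"
  using assms by (auto simp: topspace_pullback_topology hom_def)

lemma continuous_map_from_pullback: "continuous_map (pullback_topology A f T) T f"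
  using continuous_map_pullback[OF continuous_map_id, of A f T] by simp

lemma continuous_map_into_pullback:
  assumes "continuous_map Y T (\<lambda>y. f (g y))" "\<And>y. y \<in> topspace Y \<Longrightarrow> g y \<in> A"
  shows "continuous_map Y (pullback_topology A f T) g"
  using assms by (intro continuous_map_pullback') (auto simp: o_def)

lemma homeomorphic_map_pullback:
  assumes "inj_on f A" "f ` A \<subseteq> topspace T"
  shows "homeomorphic_map (pullback_topology A f T) (subtopology T (f ` A)) f"
proof (rule bijective_open_imp_homeomorphic_map)
  have top: "topspace (pullback_topology A f T) = A"
    using assms by (auto simp: topspace_pullback_topology)
  show "continuous_map (pullback_topology A f T) (subtopology T (f ` A)) f"
    by (intro continuous_map_into_subtopology continuous_map_from_pullback) (auto simp: top)
  show "open_map (pullback_topology A f T) (subtopology T (f ` A)) f"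
    unfolding open_map_def openin_pullback_topology openin_subtopology
  proof clarify
    fix V assume "openin T V"
    moreover have "f ` (f -` V \<inter> A) = V \<inter> f ` A" by auto
    ultimately show "\<exists>W. openin T W \<and> f ` (f -` V \<inter> A) = W \<inter> f ` A" by blast
  qed
  show "f ` topspace (pullback_topology A f T) = topspace (subtopology T (f ` A))"
    using assms by (auto simp: top)
  show "inj_on f (topspace (pullback_topology A f T))" using assms by (simp add: top)
qed

text \<open>\<open>f\<close> is a homeomorphism onto a closed subgroup, and closed subspaces inherit
  complete metrizability. Pulling back along a parametrisation, instead of restricting
  \<open>T\<close>, puts the topologies of different subgroups on one type, where they can be
  compared.\<close>

lemma polish_group_pullback:
  assumes G: "polish_group G T" and H: "group H" and f: "f \<in> hom H G" "inj_on f (carrier H)"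
    and closed: "closedin T (f ` carrier H)"
  shows "polish_group H (pullback_topology (carrier H) f T)"
proof -
  let ?P = "pullback_topology (carrier H) f T"
  have tg: "topological_group G T" using G polish_groupD by blast
  interpret H: group H by fact
  interpret group_hom H G f
    using f H tg topological_groupD by (simp add: group_hom_def group_hom_axioms_def)
  have top: "topspace ?P = carrier H" by (rule topspace_pullback_hom[OF topological_groupD(2)[OF tg] f(1)])
  have "continuous_map (prod_topology ?P ?P) ?P (\<lambda>(x, y). x \<otimes>\<^bsub>H\<^esub> y)"
  proof (rule continuous_map_into_pullback)
    have "continuous_map (prod_topology ?P ?P) T (\<lambda>p. f (fst p) \<otimes>\<^bsub>G\<^esub> f (snd p))"
      using continuous_map_compose[OF continuous_map_fst continuous_map_from_pullback]
        continuous_map_compose[OF continuous_map_snd continuous_map_from_pullback]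
      by (intro continuous_map_group_mult[OF tg]) (auto simp: o_def)
    then show "continuous_map (prod_topology ?P ?P) T (\<lambda>p. f (case p of (x, y) \<Rightarrow> x \<otimes>\<^bsub>H\<^esub> y))"
      by (rule continuous_map_eq) (auto simp: top)
  qed (auto simp: top)
  moreover have "continuous_map ?P ?P (\<lambda>x. inv\<^bsub>H\<^esub> x)"
  proof (rule continuous_map_into_pullback)
    show "continuous_map ?P T (\<lambda>x. f (inv\<^bsub>H\<^esub> x))"
      by (rule continuous_map_eq[OF continuous_map_group_inv[OF tg continuous_map_from_pullback]])
        (auto simp: top)
  qed (auto simp: top)
  ultimately have "topological_group H ?P" using H top by (simp add: topological_group_def)
  moreover have hs: "?P homeomorphic_space subtopology T (f ` carrier H)"
    using homeomorphic_map_imp_homeomorphic_space[OF homeomorphic_map_pullback[OF f(2)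
          closedin_subset[OF closed]]] .
  then have "separable_space ?P"
    using homeomorphic_separable_space second_countable_imp_separable_space second_countable_subtopology
      polish_group_second_countable[OF G] by blast
  moreover have "completely_metrizable_space ?P"
    using hs homeomorphic_completely_metrizable_space completely_metrizable_space_closedin
      polish_groupD(3)[OF G] closed by blast
  ultimately show ?thesis by (simp add: polish_group_def)
qed

definition add_group :: "'a::ab_group_add monoid" where
  "add_group = \<lparr>carrier = UNIV, mult = (+), one = 0\<rparr>"

lemma add_group_simps [simp]:
  "carrier add_group = UNIV" "x \<otimes>\<^bsub>add_group\<^esub> y = x + y" "\<one>\<^bsub>add_group\<^esub> = 0"
  by (simp_all add: add_group_def)

lemma group_add_group: "group add_group"
proof (rule groupI)
  fix x :: 'a
  show "\<exists>y\<in>carrier add_group. y \<otimes>\<^bsub>add_group\<^esub> x = \<one>\<^bsub>add_group\<^esub>"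
    by (intro bexI[of _ "- x"]) auto
qed (auto simp: add.assoc)

lemma inv_add_group [simp]: "inv\<^bsub>add_group\<^esub> x = - x"
  by (rule group.inv_equality[OF group_add_group]) auto

lemma continuous_map_add_group:
  assumes "topological_group add_group T" "continuous_map X T f" "continuous_map X T g"
  shows "continuous_map X T (\<lambda>x. f x + g x)"
  using continuous_map_group_mult[OF assms] by simp

lemma continuous_map_minus_group:
  assumes "topological_group add_group T" "continuous_map X T f"
  shows "continuous_map X T (\<lambda>x. - f x)"
  using continuous_map_group_inv[OF assms] by simp

lemma continuous_map_diff_group:
  assumes "topological_group add_group T" "continuous_map X T f" "continuous_map X T g"
  shows "continuous_map X T (\<lambda>x. f x - g x)"
  using continuous_map_add_group[OF assms(1,2) continuous_map_minus_group[OF assms(1,3)]] by simp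

lemma continuous_map_sum_group:
  assumes "topological_group add_group T" "finite I" "\<And>i. i \<in> I \<Longrightarrow> continuous_map X T (f i)"
  shows "continuous_map X T (\<lambda>x. \<Sum>i\<in>I. f i x)"
  using assms(2,3)
proof (induction I rule: finite_induct)
  case empty
  then show ?case using topological_groupD(2)[OF assms(1)] by simp
next
  case (insert i I)
  then show ?case by (simp add: continuous_map_add_group[OF assms(1)])
qed

lemma polish_group_euclidean: "polish_group add_group (euclidean :: 'a::euclidean_space topology)"
  unfolding polish_group_def topological_group_def
proof (intro conjI)
  show "continuous_map (prod_topology euclidean euclidean) euclidean (\<lambda>(x::'a, y). x \<otimes>\<^bsub>add_group\<^esub> y)"
    by (simp add: case_prod_unfold euclidean_product_topology continuous_on_fst continuous_on_snd continuous_on_add)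
  show "continuous_map euclidean euclidean (\<lambda>x::'a. inv\<^bsub>add_group\<^esub> x)"
    by (simp add: continuous_on_minus)
qed (auto intro: group_add_group second_countable_imp_separable_space second_countable_euclidean
    completely_metrizable_space_euclidean)

section \<open>Polish ring topologies on the real line\<close>

definition hyperbola_group :: "(real \<times> real) monoid" where
  "hyperbola_group = \<lparr>carrier = {(x, y). x * y = 1}, mult = (\<lambda>(a, b) (c, d). (a * c, b * d)), one = (1, 1)\<rparr>"

lemma hyperbola_group_simps [simp]:
  "carrier hyperbola_group = {p. fst p * snd p = 1}"
  "p \<otimes>\<^bsub>hyperbola_group\<^esub> q = (fst p * fst q, snd p * snd q)" "\<one>\<^bsub>hyperbola_group\<^esub> = (1, 1)"
  by (auto simp: hyperbola_group_def case_prod_unfold)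

lemma group_hyperbola_group: "group hyperbola_group"
proof (rule groupI)
  fix p assume "p \<in> carrier hyperbola_group"
  then show "\<exists>q\<in>carrier hyperbola_group. q \<otimes>\<^bsub>hyperbola_group\<^esub> p = \<one>\<^bsub>hyperbola_group\<^esub>"
    by (intro bexI[of _ "(snd p, fst p)"]) (auto simp: mult.commute)
next
  fix p q assume "p \<in> carrier hyperbola_group" "q \<in> carrier hyperbola_group"
  then have "(fst p * snd p) * (fst q * snd q) = 1" by simp
  then show "p \<otimes>\<^bsub>hyperbola_group\<^esub> q \<in> carrier hyperbola_group" by (simp add: algebra_simps)
qed (auto simp: mult.assoc)

lemma inv_hyperbola_group:
  "p \<in> carrier hyperbola_group \<Longrightarrow> inv\<^bsub>hyperbola_group\<^esub> p = (snd p, fst p)"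
  by (rule group.inv_equality[OF group_hyperbola_group]) (auto simp: mult.commute)

context
  fixes T :: "real topology"
  assumes polish: "polish_group add_group T"
    and mult: "continuous_map (prod_topology T T) T (\<lambda>(x, y). x * y)"
begin

private lemma tg: "topological_group add_group T"
  using polish polish_groupD by blast

private lemma top: "topspace T = UNIV"
  using topological_groupD(2)[OF tg] by simp

private lemma cont_mult:
  assumes "continuous_map X T f" "continuous_map X T g"
  shows "continuous_map X T (\<lambda>x. f x * g x)"
proof -
  have "continuous_map X (prod_topology T T) (\<lambda>x. (f x, g x))"
    using assms by (simp add: continuous_map_pairedI)
  from continuous_map_compose[OF this mult] show ?thesis by (simp add: o_def)
qed

private lemma t1: "t1_space T"
  using Hausdorff_imp_t1_space Hausdorff_polish_group polish by blast

private lemma polish_hyperbola: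
  "polish_group hyperbola_group (subtopology (prod_topology T T) {p. fst p * snd p = 1})"
  (is "polish_group _ ?P")
proof -
  have topP: "topspace ?P = carrier hyperbola_group" by (auto simp: top)
  have fs: "continuous_map Y T (\<lambda>x. fst (f x))" "continuous_map Y T (\<lambda>x. snd (f x))"
    if "continuous_map Y ?P f" for Y :: "'c topology" and f
    using that continuous_map_compose[OF _ continuous_map_fst] continuous_map_compose[OF _ continuous_map_snd]
    by (auto simp: continuous_map_in_subtopology o_def)
  have "continuous_map (prod_topology ?P ?P) ?P (\<lambda>p. fst p \<otimes>\<^bsub>hyperbola_group\<^esub> snd p)"
  proof (rule continuous_map_into_subtopology)
    show "continuous_map (prod_topology ?P ?P) (prod_topology T T) (\<lambda>p. fst p \<otimes>\<^bsub>hyperbola_group\<^esub> snd p)"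
      unfolding hyperbola_group_simps
      by (intro continuous_map_pairedI cont_mult fs) (auto simp: continuous_map_fst continuous_map_snd)
    show "(\<lambda>p. fst p \<otimes>\<^bsub>hyperbola_group\<^esub> snd p) \<in> topspace (prod_topology ?P ?P) \<rightarrow> {p. fst p * snd p = 1}"
      by (auto simp: algebra_simps)
  qed
  moreover have "continuous_map ?P ?P (\<lambda>p. inv\<^bsub>hyperbola_group\<^esub> p)"
  proof (rule continuous_map_eq)
    show "continuous_map ?P ?P (\<lambda>p. (snd p, fst p))"
      by (intro continuous_map_into_subtopology continuous_map_pairedI fs[OF continuous_map_id[unfolded id_def]])
        (auto simp: mult.commute)
  qed (auto simp: inv_hyperbola_group)
  moreover have "closedin (prod_topology T T) {p. fst p * snd p = 1}"
  proof -
    have "closedin (prod_topology T T) {p \<in> topspace (prod_topology T T). fst p * snd p \<in> {1}}"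
      by (rule closedin_continuous_map_preimage[OF cont_mult[OF continuous_map_fst continuous_map_snd]])
        (simp add: closedin_t1_singleton[OF t1] top)
    then show ?thesis by (simp add: top)
  qed
  ultimately show ?thesis
    using polish_group_second_countable[OF polish] polish_groupD(3)[OF polish] group_hyperbola_group topP
    unfolding polish_group_def topological_group_def case_prod_unfold
    by (auto intro: second_countable_imp_separable_space second_countable_subtopology second_countable_prod_topology
        completely_metrizable_space_closedin simp: completely_metrizable_space_prod_topology)
qed

text \<open>Multiplication by squares has two orbits on the nonzero numbers, the half lines, and
  negation exchanges them. Two copies of either orbit therefore cover the space, and Effros' theorem
  makes the orbits open.\<close>

private lemma openin_positive: "openin T {0<..}"
proof -
  let ?P = "subtopology (prod_topology T T) {p. fst p * snd p = 1}"
  let ?X = "subtopology T (- {0})"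
  have topX: "topspace ?X = - {0}" by (simp add: top)
  have opX: "openin T (- {0})"
    using closedin_t1_singleton[OF t1, of 0] by (simp add: closedin_def top Compl_eq_Diff_UNIV)
  interpret polish_action hyperbola_group ?P ?X "\<lambda>p v. (fst p)\<^sup>2 * v"
  proof
    show "polish_group hyperbola_group ?P" by (rule polish_hyperbola)
    show "completely_metrizable_space ?X"
      using completely_metrizable_space_openin polish_groupD(3)[OF polish] opX by blast
    show "continuous_map (prod_topology ?P ?X) ?X (\<lambda>(p, v). (fst p)\<^sup>2 * v)"
    proof (rule continuous_map_into_subtopology)
      have "continuous_map (prod_topology ?P ?X) T (\<lambda>z. fst (fst z))"
      proof -
        have "continuous_map ?P T fst"
          by (rule continuous_map_from_subtopology[OF continuous_map_fst])
        from continuous_map_compose[OF continuous_map_fst this] show ?thesis by (simp add: o_def)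
      qed
      moreover have "continuous_map (prod_topology ?P ?X) T snd"
        using continuous_map_snd continuous_map_into_fulltopology by blast
      ultimately show "continuous_map (prod_topology ?P ?X) T (\<lambda>(p, v). (fst p)\<^sup>2 * v)"
        unfolding case_prod_unfold power2_eq_square by (intro cont_mult)
    qed (auto simp: top)
  qed (auto simp: power_mult_distrib)
  define h where "h i = (if i = 0 then id else uminus :: real \<Rightarrow> real)" for i :: nat
  have "continuous_map T T (\<lambda>x. - x)"
    using continuous_map_minus_group[OF tg continuous_map_id[unfolded id_def]] .
  then have "continuous_map ?X ?X uminus"
    by (intro continuous_map_into_subtopology continuous_map_from_subtopology) auto
  then have "homeomorphic_maps ?X ?X uminus uminus"
    unfolding homeomorphic_maps_def by simp
  then have "homeomorphic_map ?X ?X (h i)" for i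
    using homeomorphic_map_maps by (auto simp: h_def)
  moreover have "topspace ?X \<subseteq> (\<Union>i. h i ` ((\<lambda>p. (fst p)\<^sup>2 * x) ` carrier hyperbola_group))"
    if "x \<in> topspace ?X" for x
  proof
    fix y assume "y \<in> topspace ?X"
    then have xy: "x \<noteq> 0" "y \<noteq> 0" using that by (auto simp: topX)
    \<comment> \<open>A square reaches \<open>\<bar>y / x\<bar>\<close> only; the sign of the
      quotient is left to \<open>h 0\<close> or \<open>h 1\<close>.\<close>
    define r where "r = sqrt \<bar>y / x\<bar>"
    have r: "r \<noteq> 0" "r\<^sup>2 = \<bar>y / x\<bar>" using xy by (auto simp: r_def)
    have p: "(r, 1 / r) \<in> carrier hyperbola_group" using r by simp
    show "y \<in> (\<Union>i. h i ` ((\<lambda>p. (fst p)\<^sup>2 * x) ` carrier hyperbola_group))"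
    proof (cases "y / x > 0")
      case True
      then have "r\<^sup>2 = y / x" using r(2) by linarith
      then have "y = h 0 ((fst (r, 1 / r))\<^sup>2 * x)" using xy by (simp add: h_def)
      then show ?thesis using p by blast
    next
      case False
      then have "r\<^sup>2 = - (y / x)" using r(2) by linarith
      then have "y = h 1 ((fst (r, 1 / r))\<^sup>2 * x)" using xy by (simp add: h_def)
      then show ?thesis using p by blast
    qed
  qed
  moreover have "openin ?P (carrier hyperbola_group)"
    using openin_topspace[of ?P] topological_groupD(2)[OF topgroup] by simp
  ultimately have V: "\<exists>V. openin ?X V \<and> x \<in> V \<and> V \<subseteq> (\<lambda>p. (fst p)\<^sup>2 * x) ` carrier hyperbola_group"
    if "x \<in> topspace ?X" for x
    using orbit_map_open[of h x "carrier hyperbola_group"] that by auto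
  show ?thesis
  proof (subst openin_subopen, intro ballI)
    fix x :: real assume x: "x \<in> {0<..}"
    then have "x \<in> topspace ?X" unfolding topX by simp
    from V[OF this] obtain V where V: "openin ?X V" "x \<in> V" "V \<subseteq> (\<lambda>p. (fst p)\<^sup>2 * x) ` carrier hyperbola_group"
      by blast
    have "(fst p)\<^sup>2 * x > 0" if "p \<in> carrier hyperbola_group" for p
      using that x by (auto intro!: mult_pos_pos)
    then have "V \<subseteq> {0<..}" using V(3) by fastforce
    moreover have "openin T V" using V(1) opX openin_trans_full by blast
    ultimately show "\<exists>S. openin T S \<and> x \<in> S \<and> S \<subseteq> {0<..}" using V(2) by blast
  qed
qed

text \<open>The squares of the invertible elements form an open set, which recovers the order and
  hence the usual topology.\<close>

lemma polish_ring_topology_real: "T = euclidean"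
proof -
  have "continuous_map T euclidean (\<lambda>x. x)"
  proof (simp add: continuous_map_def top, intro allI impI)
    fix U :: "real set" assume U: "open U"
    show "openin T U"
    proof (subst openin_subopen, intro ballI)
      fix x assume "x \<in> U"
      then obtain e where e: "e > 0" "ball x e \<subseteq> U" using U openE by blast
      \<comment> \<open>An interval is the intersection of a translate of the positive half line and
        a translate of its reflection, both open since \<open>T\<close> is a group topology.\<close>
      let ?A = "{y \<in> topspace T. y - (x - e) \<in> {0<..}}" and ?B = "{y \<in> topspace T. (x + e) - y \<in> {0<..}}"
      have "openin T ?A" "openin T ?B"
        by (intro openin_continuous_map_preimage[OF continuous_map_diff_group[OF tg] openin_positive];
            simp add: top)+
      then have "openin T (?A \<inter> ?B)" by blast
      moreover have "x \<in> ?A \<inter> ?B" using e by (simp add: top)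
      moreover have "?A \<inter> ?B \<subseteq> ball x e" by (auto simp: dist_real_def)
      ultimately show "\<exists>S. openin T S \<and> x \<in> S \<and> S \<subseteq> U" using e by blast
    qed
  qed
  then show ?thesis using polish_group_topology_unique[OF polish polish_group_euclidean] by blast
qed

end

section \<open>Transvections and centralizers\<close>

lemma matrix_inv_inverse:
  fixes A :: "real^'n^'n"
  assumes "det A \<noteq> 0"
  shows "A ** matrix_inv A = mat 1" "matrix_inv A ** A = mat 1"
proof -
  have "\<exists>B. A ** B = mat 1 \<and> B ** A = mat 1"
    using assms invertible_det_nz[of A] unfolding invertible_def by blast
  from someI_ex[OF this] show "A ** matrix_inv A = mat 1" "matrix_inv A ** A = mat 1"
    unfolding matrix_inv_def by auto
qed

lemma det_matrix_inv:
  fixes A :: "real^'n^'n"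
  assumes "det A \<noteq> 0"
  shows "det (matrix_inv A) = 1 / det A"
  using matrix_inv_inverse(1)[OF assms] assms by (metis det_I det_mul mult.commute nonzero_eq_divide_eq)

definition transvection :: "'n::finite \<Rightarrow> 'n \<Rightarrow> real \<Rightarrow> real^'n^'n" where
  "transvection i j t = (\<chi> k l. (if k = l then 1 else 0) + (if k = i \<and> l = j then t else 0))"

definition diagonal :: "('n::finite \<Rightarrow> real) \<Rightarrow> real^'n^'n" where
  "diagonal d = (\<chi> k l. if k = l then d k else 0)"

lemma transvection_nth:
  "transvection i j t $ k $ l = (if k = l then 1 else 0) + (if k = i \<and> l = j then t else 0)"
  by (simp add: transvection_def)

lemma transvection_vector: "transvection i j t *v x = x + axis i (t * x $ j)"
  by (auto simp: vec_eq_iff matrix_vector_mult_def transvection_def axis_def distrib_right sum.distrib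
      if_distribR if_distrib[of "\<lambda>x. x * _"] cong: if_cong)

lemma transvection_mult: "(transvection i j t ** A) $ k $ l = A $ k $ l + (if k = i then t * A $ j $ l else 0)"
  by (auto simp: matrix_matrix_mult_def transvection_def distrib_right sum.distrib
      if_distrib[of "\<lambda>x. x * _"] cong: if_cong)

lemma mult_transvection: "(A ** transvection i j t) $ k $ l = A $ k $ l + (if l = j then A $ k $ i * t else 0)"
  by (auto simp: matrix_matrix_mult_def transvection_def distrib_left sum.distrib
      if_distrib[of "\<lambda>x. _ * x"] cong: if_cong)

lemma transvection_add: "i \<noteq> j \<Longrightarrow> transvection i j s ** transvection i j t = transvection i j (s + t)"
  by (auto simp: vec_eq_iff transvection_mult transvection_nth)

lemma det_transvection:
  assumes "i \<noteq> j"
  shows "det (transvection i j t) = 1"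
proof -
  have "transvection i j t = (\<chi> k. if k = i then row i (mat 1) + t *s row j (mat 1) else row k (mat 1))"
    using assms by (auto simp: vec_eq_iff transvection_def row_def mat_def)
  then show ?thesis using det_row_operation[OF assms, of "mat 1" t] by simp
qed

lemma diagonal_vector: "(diagonal d *v x) $ k = d k * x $ k"
  by (simp add: matrix_vector_mult_def diagonal_def if_distrib[of "\<lambda>x. x * _"] cong: if_cong)

lemma diagonal_mult: "(diagonal d ** A) $ k $ l = d k * A $ k $ l"
  by (simp add: matrix_matrix_mult_def diagonal_def if_distrib[of "\<lambda>x. x * _"] cong: if_cong)

lemma mult_diagonal: "(A ** diagonal d) $ k $ l = A $ k $ l * d l"
  by (simp add: matrix_matrix_mult_def diagonal_def if_distrib[of "\<lambda>x. _ * x"] cong: if_cong)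

lemma det_diagonal_prod: "det (diagonal d) = prod d UNIV"
  by (subst det_diagonal) (auto simp: diagonal_def)

lemma matrix_vector_mult_minus: "(A :: real^'n^'m) *v (- x) = - (A *v x)"
  by (simp add: vec_eq_iff matrix_vector_mult_def sum_negf)

lemma matrix_eq_columns:
  fixes A B :: "real^'n^'m"
  assumes "\<And>j. A *v axis j 1 = B *v axis j 1"
  shows "A = B"
proof -
  have "column j A = column j B" for j using assms[of j] by (simp add: matrix_vector_mult_basis)
  then show ?thesis by (auto simp: vec_eq_iff column_def)
qed

text \<open>What the four groups share. \<open>SL_subset\<close> supplies the transvections and the
  diagonal matrices of determinant 1 that occur in centralizers and commutators.\<close>

locale matrix_group =
  fixes S :: "(real^'n^'n) set"
  assumes SL_subset: "SL \<subseteq> S" and subset_GL: "S \<subseteq> GL"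
    and mult_closed: "A \<in> S \<Longrightarrow> B \<in> S \<Longrightarrow> A ** B \<in> S"
    and inv_closed: "A \<in> S \<Longrightarrow> matrix_inv A \<in> S"
    and two_le_card: "CARD('n) \<ge> 2"
begin

abbreviation G where "G \<equiv> semidirect S"

definition translation :: "real^'n \<Rightarrow> (real^'n) \<times> (real^'n^'n)" where
  "translation x = (x, mat 1)"

definition linear_part :: "real^'n^'n \<Rightarrow> (real^'n) \<times> (real^'n^'n)" where
  "linear_part A = (0, A)"

lemma semidirect_simps [simp]:
  "carrier G = UNIV \<times> S"
  "p \<otimes>\<^bsub>G\<^esub> q = (fst p + snd p *v fst q, snd p ** snd q)"
  "\<one>\<^bsub>G\<^esub> = (0, mat 1)"
  by (simp_all add: semidirect_def case_prod_unfold)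

lemma det_nz: "A \<in> S \<Longrightarrow> det A \<noteq> 0"
  using subset_GL by (auto simp: GL_def invertible_det_nz)

lemma det_1_mem: "det A = 1 \<Longrightarrow> A \<in> S"
  using SL_subset by (auto simp: SL_def GL_def invertible_det_nz)

lemma one_mem: "mat 1 \<in> S"
  by (rule det_1_mem) simp

lemma group_semidirect: "group G"
proof (rule groupI)
  fix p assume "p \<in> carrier G"
  then have "snd p \<in> S" by auto
  then show "\<exists>q\<in>carrier G. q \<otimes>\<^bsub>G\<^esub> p = \<one>\<^bsub>G\<^esub>"
    using matrix_inv_inverse[OF det_nz]
    by (intro bexI[of _ "(- (matrix_inv (snd p) *v fst p), matrix_inv (snd p))"]) (auto simp: inv_closed)
qed (auto simp: mult_closed one_mem matrix_mul_assoc matrix_vector_right_distrib matrix_vector_mul_assoc)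

lemma inv_semidirect:
  assumes "p \<in> carrier G"
  shows "inv\<^bsub>G\<^esub> p = (- (matrix_inv (snd p) *v fst p), matrix_inv (snd p))"
proof (rule group.inv_equality[OF group_semidirect])
  have "snd p \<in> S" using assms by auto
  then show "(- (matrix_inv (snd p) *v fst p), matrix_inv (snd p)) \<otimes>\<^bsub>G\<^esub> p = \<one>\<^bsub>G\<^esub>"
    "(- (matrix_inv (snd p) *v fst p), matrix_inv (snd p)) \<in> carrier G"
    using matrix_inv_inverse[OF det_nz] by (auto simp: inv_closed)
qed (use assms in auto)

lemma translation_carrier: "translation x \<in> carrier G"
  by (simp add: translation_def one_mem)

lemma linear_part_carrier: "A \<in> S \<Longrightarrow> linear_part A \<in> carrier G"
  by (simp add: linear_part_def)

lemma transvection_mem: "i \<noteq> j \<Longrightarrow> transvection i j t \<in> S"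
  by (simp add: det_1_mem det_transvection)

lemma other_index: "\<exists>j. (j::'n) \<noteq> i"
proof (rule ccontr)
  assume "\<nexists>j. j \<noteq> i"
  then have "UNIV = {i}" by auto
  then have "CARD('n) = card {i}" by (rule arg_cong)
  then show False using two_le_card by simp
qed

lemma conj_translation:
  assumes "p \<in> carrier G"
  shows "p \<otimes>\<^bsub>G\<^esub> translation x \<otimes>\<^bsub>G\<^esub> inv\<^bsub>G\<^esub> p = translation (snd p *v x)"
proof -
  have "snd p \<in> S" using assms by auto
  note inv = matrix_inv_inverse[OF det_nz[OF this]]
  have "snd p *v (matrix_inv (snd p) *v fst p) = fst p"
    by (simp add: matrix_vector_mul_assoc inv)
  then show ?thesis
    by (simp add: inv_semidirect[OF assms] translation_def inv matrix_vector_mult_minus)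
qed

lemma translation_hom: "translation \<in> hom add_group G"
  by (auto simp: hom_def translation_def one_mem)

lemma transvection_hom: "i \<noteq> j \<Longrightarrow> (\<lambda>t. linear_part (transvection i j t)) \<in> hom add_group G"
  by (auto simp: hom_def linear_part_def transvection_mem transvection_add)

lemma translation_iff_commute:
  assumes "p \<in> carrier G"
  shows "p \<otimes>\<^bsub>G\<^esub> translation x = translation x \<otimes>\<^bsub>G\<^esub> p \<longleftrightarrow> snd p *v x = x"
  by (simp add: translation_def add.commute)

text \<open>Commuting with the translation by \<open>x\<close> means that the linear part fixes
  \<open>x\<close>; fixing every basis vector leaves only the identity matrix.\<close>

lemma range_translation:
  "range translation = {p \<in> carrier G. \<forall>j\<in>UNIV. p \<otimes>\<^bsub>G\<^esub> translation (axis j 1) = translation (axis j 1) \<otimes>\<^bsub>G\<^esub> p}"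
  (is "?L = ?R")
proof
  show "?L \<subseteq> ?R" by (auto simp: translation_def one_mem add.commute)
  show "?R \<subseteq> ?L"
  proof
    fix p assume p: "p \<in> ?R"
    then have "snd p *v axis j 1 = axis j 1" for j using translation_iff_commute by blast
    then have "snd p = mat 1" by (intro matrix_eq_columns) simp
    then show "p \<in> ?L" by (auto simp: translation_def image_iff) (metis prod.collapse)
  qed
qed

text \<open>The transvection at \<open>(i, k)\<close> adds \<open>x $ k\<close> to the
  \<open>i\<close>-th coordinate, so it fixes \<open>x\<close> exactly when
  \<open>x $ k = 0\<close>. As a set of common fixed points the axis is visibly closed.\<close>

lemma range_axis: "range (\<lambda>t. axis i t) = {x :: real^'n. \<forall>k\<in>-{i}. transvection i k 1 *v x = x}"
proof -
  have "transvection i k 1 *v x = x \<longleftrightarrow> x $ k = 0" for x :: "real^'n" and k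
    by (simp add: transvection_vector)
  moreover have "x \<in> range (axis i) \<longleftrightarrow> (\<forall>k\<in>-{i}. x $ k = 0)" for x :: "real^'n"
  proof
    assume "\<forall>k\<in>-{i}. x $ k = 0"
    then have "x = axis i (x $ i)" by (auto simp: vec_eq_iff axis_def)
    then show "x \<in> range (axis i)" by blast
  qed (auto simp: axis_def split: if_splits)
  ultimately show ?thesis by auto
qed

text \<open>Flipping two signs keeps the determinant 1, and conjugation multiplies an entry at
  \<open>(i, j)\<close> by both signs, so transvections at that position commute with the
  flip.\<close>

definition sign_flip :: "'n \<Rightarrow> 'n \<Rightarrow> real^'n^'n" where
  "sign_flip i j = diagonal (\<lambda>k. if k = i \<or> k = j then -1 else 1)"

lemma sign_flip_mem:
  assumes "i \<noteq> j"
  shows "sign_flip i j \<in> S"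
proof (rule det_1_mem)
  have "prod (\<lambda>k. if k = i \<or> k = j then -1 else 1 :: real) UNIV = (\<Prod>k\<in>{i, j}. - 1)"
    by (rule prod.mono_neutral_cong_right) auto
  also have "\<dots> = 1" using assms by simp
  finally show "det (sign_flip i j) = 1" by (simp add: sign_flip_def det_diagonal_prod)
qed

text \<open>The three families of test elements divide the work. Translations along the axes
  \<open>k \<noteq> j\<close> fix all columns except the \<open>j\<close>-th. Transvections at
  \<open>(i, k)\<close> reduce that column to a diagonal 1 and a free entry in row \<open>i\<close>,
  and kill \<open>x $ k\<close> for \<open>k \<noteq> i\<close>. The sign flip kills the remaining
  \<open>x $ i\<close>.\<close>

lemma range_transvection:
  assumes "i \<noteq> j"
  shows "range (\<lambda>t. linear_part (transvection i j t)) =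
    {p \<in> carrier G. \<forall>h \<in> (\<lambda>k. translation (axis k 1)) ` (-{j}) \<union> (\<lambda>k. linear_part (transvection i k 1)) ` (-{i})
        \<union> {linear_part (sign_flip i j)}. p \<otimes>\<^bsub>G\<^esub> h = h \<otimes>\<^bsub>G\<^esub> p}"
  (is "?L = ?R")
proof
  show "?L \<subseteq> ?R"
    using assms transvection_mem[OF assms]
    by (auto simp: linear_part_def translation_def transvection_vector vec_eq_iff transvection_mult mult_transvection
        transvection_nth sign_flip_def diagonal_mult mult_diagonal axis_def)
  show "?R \<subseteq> ?L"
  proof
    fix p assume p: "p \<in> ?R"
    obtain x A where xA: "p = (x, A)" by fastforce
    have "A *v axis k 1 = axis k 1" if "k \<noteq> j" for k
      using p that translation_iff_commute[of p] by (auto simp: xA)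
    then have "column k A = axis k 1" if "k \<noteq> j" for k
      using that by (simp add: matrix_vector_mult_basis)
    then have col: "A $ r $ k = (if r = k then 1 else 0)" if "k \<noteq> j" for k r
      using that by (auto simp: column_def vec_eq_iff axis_def)
    have comm: "transvection i k 1 *v x = x \<and> A ** transvection i k 1 = transvection i k 1 ** A" if "k \<noteq> i" for k
    proof -
      have "p \<otimes>\<^bsub>G\<^esub> linear_part (transvection i k 1) = linear_part (transvection i k 1) \<otimes>\<^bsub>G\<^esub> p"
        using p that by blast
      then show ?thesis by (auto simp: linear_part_def xA)
    qed
    have flip: "sign_flip i j *v x = x"
      using p by (auto simp: linear_part_def xA)
    have "x $ k = 0" for k
    proof (cases "k = i")
      case True
      have "(sign_flip i j *v x) $ i = x $ i" by (simp only: flip)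
      then show ?thesis using True by (simp add: sign_flip_def diagonal_vector)
    next
      case False
      then have "(transvection i k 1 *v x) $ i = x $ i" using comm by simp
      then show ?thesis by (simp add: transvection_vector)
    qed
    then have x0: "x = 0" by (simp add: vec_eq_iff)
    have "A $ i $ i = 1" using col[of i i] assms by simp
    have colj: "A $ k $ j = (if j = k then 1 else 0)" if "k \<noteq> i" for k
    proof -
      have "(A ** transvection i k 1) $ i $ j = (transvection i k 1 ** A) $ i $ j"
        using comm[OF that] by simp
      then have "(if j = k then A $ i $ i else 0) = A $ k $ j"
        unfolding transvection_mult mult_transvection by (auto split: if_splits)
      then show ?thesis using \<open>A $ i $ i = 1\<close> by (cases "j = k") auto
    qed
    define t where "t = A $ i $ j"
    have "A $ k $ l = transvection i j t $ k $ l" for k l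
    proof (cases "l = j")
      case True
      then show ?thesis using colj[of k] assms by (cases "k = i") (auto simp: transvection_nth t_def)
    next
      case False
      then show ?thesis using col[of l k] by (simp add: transvection_nth)
    qed
    then have "A = transvection i j t" by (simp add: vec_eq_iff)
    then show "p \<in> ?L" using x0 xA by (auto simp: linear_part_def)
  qed
qed

end

section \<open>Polish topologies on the semidirect product\<close>

lemma closedin_equalizers:
  assumes "Hausdorff_space Y" "\<And>k. k \<in> K \<Longrightarrow> continuous_map X Y (f k)" "\<And>k. k \<in> K \<Longrightarrow> continuous_map X Y (g k)"
  shows "closedin X {x \<in> topspace X. \<forall>k\<in>K. f k x = g k x}"
\<comment> \<open>For empty \<open>K\<close> the intersection below would be the whole type instead
  of the whole space.\<close>
proof (cases "K = {}")
  case False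
  then have "{x \<in> topspace X. \<forall>k\<in>K. f k x = g k x} = (\<Inter>k\<in>K. {x \<in> topspace X. f k x = g k x})" by auto
  moreover have "closedin X (\<Inter>k\<in>K. {x \<in> topspace X. f k x = g k x})"
    using False assms by (intro closedin_INT closedin_continuous_maps_eq[where Y = Y]) auto
  ultimately show ?thesis by simp
qed simp

lemma closedin_centralizer:
  assumes "polish_group G T" "H \<subseteq> carrier G"
  shows "closedin T {x \<in> carrier G. \<forall>h\<in>H. x \<otimes>\<^bsub>G\<^esub> h = h \<otimes>\<^bsub>G\<^esub> x}"
proof -
  have tg: "topological_group G T" using assms polish_groupD by blast
  have top: "topspace T = carrier G" using tg topological_groupD by blast
  have "closedin T {x \<in> topspace T. \<forall>h\<in>H. x \<otimes>\<^bsub>G\<^esub> h = h \<otimes>\<^bsub>G\<^esub> x}"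
    using assms
    by (intro closedin_equalizers[OF Hausdorff_polish_group[OF assms(1)]] continuous_map_group_mult[OF tg])
      (auto simp: top)
  then show ?thesis by (simp add: top)
qed

locale polish_semidirect = matrix_group S for S :: "(real^'n^'n) set" +
  fixes T :: "((real^'n) \<times> (real^'n^'n)) topology"
  assumes polish: "polish_group (semidirect S) T"
begin

lemma tg: "topological_group G T"
  using polish polish_groupD by blast

lemma top: "topspace T = UNIV \<times> S"
  using topological_groupD(2)[OF tg] by simp

definition translation_topology where
  "translation_topology = pullback_topology UNIV translation T"

definition line_topology where
  "line_topology i = pullback_topology UNIV (axis i) translation_topology"

definition transvection_topology where
  "transvection_topology i j = pullback_topology UNIV (\<lambda>t. linear_part (transvection i j t)) T"

lemma polish_translation_topology: "polish_group add_group translation_topology"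
proof -
  have "closedin T (range translation)"
    unfolding range_translation
    using closedin_centralizer[OF polish, of "range (\<lambda>j. translation (axis j 1))"] translation_carrier
    by auto
  then show ?thesis
    using polish_group_pullback[OF polish group_add_group translation_hom]
    by (auto simp: translation_topology_def translation_def inj_on_def)
qed

lemma tg_translation: "topological_group add_group translation_topology"
  using polish_translation_topology polish_groupD by blast

lemma top_translation: "topspace translation_topology = UNIV"
  using topological_groupD(2)[OF tg_translation] by simp

text \<open>Conjugating the translation by \<open>v\<close> with \<open>p\<close> gives the
  translation by \<open>snd p *v v\<close>, so joint continuity of the matrix action follows from
  continuity of the group operations alone.\<close>

lemma continuous_map_linear_action:
  assumes f: "continuous_map X T f" and g: "continuous_map X translation_topology g"
  shows "continuous_map X translation_topology (\<lambda>z. snd (f z) *v g z)"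
  unfolding translation_topology_def
proof (rule continuous_map_into_pullback)
  have "continuous_map X T (\<lambda>z. translation (g z))"
    using continuous_map_compose[OF g[unfolded translation_topology_def] continuous_map_from_pullback]
    by (simp add: o_def)
  then have "continuous_map X T (\<lambda>z. f z \<otimes>\<^bsub>G\<^esub> translation (g z) \<otimes>\<^bsub>G\<^esub> inv\<^bsub>G\<^esub> (f z))"
    by (intro continuous_map_group_mult[OF tg] continuous_map_group_inv[OF tg] f)
  then show "continuous_map X T (\<lambda>z. translation (snd (f z) *v g z))"
  proof (rule continuous_map_eq)
    fix z assume "z \<in> topspace X"
    then have "f z \<in> carrier G" using continuous_map_funspace[OF f] top by auto
    then show "f z \<otimes>\<^bsub>G\<^esub> translation (g z) \<otimes>\<^bsub>G\<^esub> inv\<^bsub>G\<^esub> (f z) = translation (snd (f z) *v g z)"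
      by (rule conj_translation)
  qed
qed auto

lemma continuous_map_const_linear:
  assumes "A \<in> S" and g: "continuous_map X translation_topology g"
  shows "continuous_map X translation_topology (\<lambda>z. A *v g z)"
  using continuous_map_linear_action[OF _ g, of "\<lambda>_. linear_part A"] assms(1)
  by (simp add: linear_part_def top)

lemma polish_line_topology: "polish_group add_group (line_topology i)"
proof -
  have "closedin translation_topology {x \<in> topspace translation_topology. \<forall>k\<in>-{i}. transvection i k 1 *v x = x}"
    by (intro closedin_equalizers[OF Hausdorff_polish_group[OF polish_translation_topology]]
        continuous_map_const_linear transvection_mem) (auto simp: id_def[symmetric])
  then have "closedin translation_topology (range (axis i))"
    by (simp add: top_translation range_axis)
  moreover have "axis i \<in> hom add_group add_group"
    by (auto simp: hom_def vec_eq_iff axis_def)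
  ultimately show ?thesis
    using polish_group_pullback[OF polish_translation_topology group_add_group, of "axis i"]
    by (auto simp: line_topology_def inj_on_def axis_eq_axis)
qed

lemma tg_line: "topological_group add_group (line_topology i)"
  using polish_line_topology polish_groupD by blast

lemma polish_transvection_topology:
  assumes "i \<noteq> j"
  shows "polish_group add_group (transvection_topology i j)"
proof -
  have "closedin T (range (\<lambda>t. linear_part (transvection i j t)))"
    unfolding range_transvection[OF assms]
    by (intro closedin_centralizer[OF polish] Un_least image_subsetI insert_subsetI empty_subsetI
        translation_carrier linear_part_carrier transvection_mem sign_flip_mem assms) auto
  moreover have "inj (\<lambda>t. linear_part (transvection i j t))"
  proof (rule injI)
    fix s t assume "linear_part (transvection i j s) = linear_part (transvection i j t)"
    then have "transvection i j s $ i $ j = transvection i j t $ i $ j" by (simp add: linear_part_def)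
    then show "s = t" by (simp add: transvection_nth)
  qed
  ultimately show ?thesis
    using polish_group_pullback[OF polish group_add_group transvection_hom[OF assms]]
    by (auto simp: transvection_topology_def)
qed

lemma continuous_map_axis:
  assumes "continuous_map X (line_topology i) f"
  shows "continuous_map X translation_topology (\<lambda>z. axis i (f z))"
  using continuous_map_compose[OF assms[unfolded line_topology_def] continuous_map_from_pullback]
  by (simp add: o_def)

lemma continuous_map_into_line:
  assumes "continuous_map X translation_topology (\<lambda>z. axis i (f z))"
  shows "continuous_map X (line_topology i) f"
  unfolding line_topology_def using assms by (intro continuous_map_into_pullback) auto

lemma continuous_map_transvection:
  assumes "continuous_map X (transvection_topology i j) f"
  shows "continuous_map X T (\<lambda>z. linear_part (transvection i j (f z)))"
  using continuous_map_compose[OF assms[unfolded transvection_topology_def] continuous_map_from_pullback]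
  by (simp add: o_def)

text \<open>The commutator of the transvection with entry \<open>t\<close> at \<open>(i, j)\<close>
  and the unit translation along axis \<open>j\<close> is the translation by \<open>t\<close> along
  axis \<open>i\<close>. This gives continuity in one direction, which suffices between Polish group
  topologies.\<close>

lemma transvection_topology_eq_line:
  assumes "i \<noteq> j"
  shows "transvection_topology i j = line_topology i"
proof (rule polish_group_topology_unique[OF polish_transvection_topology[OF assms] polish_line_topology])
  show "continuous_map (transvection_topology i j) (line_topology i) (\<lambda>x. x)"
  proof (rule continuous_map_into_line)
    have "continuous_map (transvection_topology i j) translation_topology
        (\<lambda>t. snd (linear_part (transvection i j t)) *v axis j 1 - axis j 1)"
      by (intro continuous_map_diff_group[OF tg_translation] continuous_map_linear_action
          continuous_map_transvection continuous_map_id[unfolded id_def]) (auto simp: top_translation)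
    then show "continuous_map (transvection_topology i j) translation_topology (\<lambda>t. axis i t)"
      by (simp add: linear_part_def transvection_vector)
  qed
qed

text \<open>Now the transvection at \<open>(i, j)\<close> is fixed and the translation varies: its
  commutator with the translation by \<open>t\<close> along axis \<open>j\<close> is the translation
  by \<open>t\<close> along axis \<open>i\<close>.\<close>

lemma line_topology_eq_line:
  assumes "i \<noteq> j"
  shows "line_topology j = line_topology i"
proof (rule polish_group_topology_unique[OF polish_line_topology polish_line_topology])
  show "continuous_map (line_topology j) (line_topology i) (\<lambda>x. x)"
  proof (rule continuous_map_into_line)
    have "continuous_map (line_topology j) translation_topology
        (\<lambda>t. transvection i j 1 *v axis j t - axis j t)"
      by (intro continuous_map_diff_group[OF tg_translation] continuous_map_const_linear
          continuous_map_axis continuous_map_id[unfolded id_def] transvection_mem assms)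
    then show "continuous_map (line_topology j) translation_topology (\<lambda>t. axis i t)"
      by (simp add: transvection_vector)
  qed
qed

text \<open>The product of \<open>s\<close> and \<open>t\<close> is read off from the commutator of the transvection with entry
  \<open>s\<close> at \<open>(i, j)\<close> and the translation by \<open>t\<close> along the \<open>j\<close>-th axis.\<close>

lemma line_topology_eq_euclidean: "line_topology i = euclidean"
proof -
  obtain j where j: "i \<noteq> j" using other_index by metis
  let ?L = "line_topology i"
  have "continuous_map (prod_topology ?L ?L) ?L (\<lambda>p. fst p * snd p)"
  proof (rule continuous_map_into_line)
    have 1: "continuous_map (prod_topology ?L ?L) (transvection_topology i j) fst"
      by (simp add: transvection_topology_eq_line[OF j] continuous_map_fst)
    have 2: "continuous_map (prod_topology ?L ?L) (line_topology j) snd"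
      by (simp add: line_topology_eq_line[OF j] continuous_map_snd)
    have "continuous_map (prod_topology ?L ?L) translation_topology
        (\<lambda>p. snd (linear_part (transvection i j (fst p))) *v axis j (snd p) - axis j (snd p))"
      by (intro continuous_map_diff_group[OF tg_translation] continuous_map_linear_action
          continuous_map_transvection continuous_map_axis 1 2)
    then show "continuous_map (prod_topology ?L ?L) translation_topology (\<lambda>p. axis i (fst p * snd p))"
      by (simp add: linear_part_def transvection_vector)
  qed
  then show ?thesis
    by (intro polish_ring_topology_real polish_line_topology) (simp add: case_prod_unfold)
qed

lemma transvection_topology_eq_euclidean: "i \<noteq> j \<Longrightarrow> transvection_topology i j = euclidean"
  by (simp add: transvection_topology_eq_line line_topology_eq_euclidean)

text \<open>A vector is the sum of its components along the axes. The continuity obtained this way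
  runs from the Euclidean topology to the unknown one, opposite to the final comparison on the whole
  group; hence \<open>sym\<close>.\<close>

lemma translation_topology_eq_euclidean: "translation_topology = euclidean"
proof (rule sym, rule polish_group_topology_unique[OF polish_group_euclidean polish_translation_topology])
  have "continuous_map euclidean translation_topology (\<lambda>x :: real^'n. axis i (x $ i))" for i
    by (rule continuous_map_axis) (simp add: line_topology_eq_euclidean continuous_on_component)
  then have "continuous_map euclidean translation_topology (\<lambda>x :: real^'n. \<Sum>i\<in>UNIV. axis i (x $ i))"
    by (intro continuous_map_sum_group[OF tg_translation]) auto
  moreover have "(\<Sum>i\<in>UNIV. axis i (x $ i)) = x" for x :: "real^'n"
    by (simp add: vec_eq_iff axis_def)
  ultimately show "continuous_map euclidean translation_topology (\<lambda>x. x)" by simp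
qed

text \<open>The \<open>l\<close>-th column of a matrix is its value at the \<open>l\<close>-th basis
  vector. The matrix is assembled as a sum of matrices supported on one column each, so continuity
  of finite sums suffices.\<close>

lemma continuous_map_snd_euclidean: "continuous_map T euclidean snd"
proof -
  have tgm: "topological_group add_group (euclidean :: (real^'n^'n) topology)"
    using polish_group_euclidean polish_groupD by blast
  have "continuous_map T euclidean (\<lambda>p. \<chi> k m. if m = l then (snd p *v axis l 1) $ k else 0)" for l
  proof -
    have "continuous_map T euclidean (\<lambda>p. snd p *v axis l 1)"
      using continuous_map_linear_action[of T "\<lambda>x. x" "\<lambda>_. axis l 1"]
      by (simp add: translation_topology_eq_euclidean id_def[symmetric])
    moreover have "continuous_map euclidean euclidean (\<lambda>v :: real^'n. (\<chi> k m. if m = l then v $ k else 0) :: real^'n^'n)"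
    proof -
      have "continuous_on UNIV (\<lambda>v :: real^'n. if m = l then v $ k else 0)" for k m
        by (cases "m = l") (auto intro: continuous_on_component)
      then show ?thesis by (simp add: continuous_on_vec_lambda)
    qed
    ultimately show ?thesis
      using continuous_map_compose[of T euclidean "\<lambda>p. snd p *v axis l 1" euclidean] by (simp add: o_def)
  qed
  then have "continuous_map T euclidean (\<lambda>p. \<Sum>l\<in>UNIV. \<chi> k m. if m = l then (snd p *v axis l 1) $ k else 0)"
    by (intro continuous_map_sum_group[OF tgm]) auto
  moreover have "(\<Sum>l\<in>UNIV. \<chi> k m. if m = l then (A *v axis l 1) $ k else 0) = A" for A :: "real^'n^'n"
    by (simp add: vec_eq_iff matrix_vector_mult_basis column_def)
  ultimately show ?thesis by simp
qed

end

section \<open>Gaussian elimination and continuity of the translation part\<close>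

text \<open>Right multiplication by \<open>row_shear\<close> and left multiplication by \<open>column_shear\<close> perform one
  step of Gaussian elimination with pivot \<open>(a, a)\<close>; the entries of the vectors at \<open>a\<close> are ignored.\<close>

definition column_shear :: "'n::finite \<Rightarrow> 'n set \<Rightarrow> real^'n \<Rightarrow> real^'n^'n" where
  "column_shear a K c = (\<chi> k l. (if k = l then 1 else 0) - (if l = a \<and> k \<in> K then c $ k else 0))"

definition row_shear :: "'n::finite \<Rightarrow> 'n set \<Rightarrow> real^'n \<Rightarrow> real^'n^'n" where
  "row_shear a K r = (\<chi> k l. (if k = l then 1 else 0) - (if k = a \<and> l \<in> K then r $ l else 0))"

lemma column_shear_vector: "(column_shear a K c *v x) $ k = x $ k - (if k \<in> K then c $ k * x $ a else 0)"
  by (simp add: matrix_vector_mult_def column_shear_def left_diff_distrib sum_subtractf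
      if_distrib[of "\<lambda>x. x * _"] cong: if_cong conj_cong)

lemma column_shear_mult: "(column_shear a K c ** A) $ k $ l = A $ k $ l - (if k \<in> K then c $ k * A $ a $ l else 0)"
  by (simp add: matrix_matrix_mult_def column_shear_def left_diff_distrib sum_subtractf
      if_distrib[of "\<lambda>x. x * _"] cong: if_cong conj_cong)

lemma mult_row_shear: "(A ** row_shear a K r) $ k $ l = A $ k $ l - (if l \<in> K then A $ k $ a * r $ l else 0)"
  by (simp add: matrix_matrix_mult_def row_shear_def right_diff_distrib sum_subtractf
      if_distrib[of "\<lambda>x. _ * x"] cong: if_cong conj_cong)

lemma column_shear_insert:
  assumes "a \<notin> insert i K" "i \<notin> K"
  shows "column_shear a (insert i K) c = transvection i a (- c $ i) ** column_shear a K c"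
  using assms by (auto simp: vec_eq_iff transvection_mult column_shear_def)

lemma row_shear_insert:
  assumes "a \<notin> insert i K" "i \<notin> K"
  shows "row_shear a (insert i K) r = row_shear a K r ** transvection a i (- r $ i)"
  using assms by (auto simp: vec_eq_iff mult_transvection row_shear_def)

lemma shear_empty: "column_shear a {} c = mat 1" "row_shear a {} r = mat 1"
  by (simp_all add: column_shear_def row_shear_def mat_def)

context polish_semidirect
begin

text \<open>A shear is a product of transvections at different positions, one for each index in
  \<open>K\<close>, and on each of these one-parameter groups \<open>T\<close> is already known to
  be Euclidean.\<close>

lemma continuous_map_column_shear:
  assumes "a \<notin> K"
  shows "continuous_map euclidean T (\<lambda>c. linear_part (column_shear a K c))"
proof -
  have "finite K" by simp
  then show ?thesis using assms
  proof (induction K rule: finite_induct)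
    case empty
    then show ?case by (simp add: shear_empty linear_part_def top one_mem)
  next
    case (insert i K)
    then have "i \<noteq> a" by auto
    have "continuous_map euclidean T (\<lambda>c :: real^'n. linear_part (transvection i a (- c $ i)))"
      by (rule continuous_map_transvection)
        (simp add: transvection_topology_eq_euclidean[OF \<open>i \<noteq> a\<close>] continuous_on_component continuous_on_minus)
    from continuous_map_group_mult[OF tg this insert.IH] insert show ?case
      by (simp add: linear_part_def column_shear_insert)
  qed
qed

lemma continuous_map_row_shear:
  assumes "a \<notin> K"
  shows "continuous_map euclidean T (\<lambda>r. linear_part (row_shear a K r))"
proof -
  have "finite K" by simp
  then show ?thesis using assms
  proof (induction K rule: finite_induct)
    case empty
    then show ?case by (simp add: shear_empty linear_part_def top one_mem)
  next
    case (insert i K)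
    then have "a \<noteq> i" by auto
    have "continuous_map euclidean T (\<lambda>r :: real^'n. linear_part (transvection a i (- r $ i)))"
      by (rule continuous_map_transvection)
        (simp add: transvection_topology_eq_euclidean[OF \<open>a \<noteq> i\<close>] continuous_on_component continuous_on_minus)
    from continuous_map_group_mult[OF tg insert.IH this] insert show ?case
      by (simp add: linear_part_def row_shear_insert)
  qed
qed

text \<open>On the chart \<open>A $ a $ a \<noteq> 0\<close>, elimination makes the linear part block diagonal, so that it
  commutes with a diagonal matrix \<open>d\<close> for which \<open>1 - d\<close> is invertible. The commutator with \<open>d\<close> is
  then a translation by \<open>(1 - d) y\<close>, where \<open>y\<close> is the translation part.\<close>

lemma continuous_map_fst_chart:
  fixes a :: 'n
  shows "continuous_map (subtopology T {p. snd p $ a $ a \<noteq> 0}) euclidean fst"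
proof -
  let ?TO = "subtopology T {p. snd p $ a $ a \<noteq> 0}"
  let ?K = "- {a}"
  define c where "c p = (\<chi> k. snd p $ k $ a / snd p $ a $ a)" for p :: "(real^'n) \<times> (real^'n^'n)"
  define r where "r p = (\<chi> l. snd p $ a $ l / snd p $ a $ a)" for p :: "(real^'n) \<times> (real^'n^'n)"
  let ?C = "\<lambda>p. linear_part (column_shear a ?K (c p))"
  let ?R = "\<lambda>p. linear_part (row_shear a ?K (r p))"
  define h where "h p = ?C p \<otimes>\<^bsub>G\<^esub> p \<otimes>\<^bsub>G\<^esub> ?R p" for p
  \<comment> \<open>The value at \<open>a\<close> balances the factors 2 to give determinant 1. The
    diagonal is constant on each of the two blocks, so it commutes with block diagonal matrices, and
    since n \<ge> 2 no entry equals 1.\<close>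
  define e :: "'n \<Rightarrow> real" where "e k = (if k = a then (1/2) ^ (CARD('n) - 1) else 2)" for k
  have snd: "continuous_map ?TO (top_of_set {A. A $ a $ a \<noteq> 0}) snd"
    by (intro continuous_map_into_subtopology continuous_map_from_subtopology continuous_map_snd_euclidean) auto
  have "continuous_on {A :: real^'n^'n. A $ a $ a \<noteq> 0} (\<lambda>A. \<chi> k. A $ k $ a / A $ a $ a)"
    "continuous_on {A :: real^'n^'n. A $ a $ a \<noteq> 0} (\<lambda>A. \<chi> l. A $ a $ l / A $ a $ a)"
    by (auto intro!: continuous_intros)
  then have cr: "continuous_map (top_of_set {A. A $ a $ a \<noteq> 0}) euclidean (\<lambda>A :: real^'n^'n. \<chi> k. A $ k $ a / A $ a $ a)"
    "continuous_map (top_of_set {A. A $ a $ a \<noteq> 0}) euclidean (\<lambda>A :: real^'n^'n. \<chi> l. A $ a $ l / A $ a $ a)"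
    by simp_all
  have "continuous_map ?TO euclidean c" "continuous_map ?TO euclidean r"
    using continuous_map_compose[OF snd cr(1)] continuous_map_compose[OF snd cr(2)]
    by (simp_all add: o_def c_def[abs_def] r_def[abs_def])
  then have C: "continuous_map ?TO T ?C" and C': "continuous_map ?TO T (\<lambda>p. linear_part (column_shear a ?K (- c p)))"
    and R: "continuous_map ?TO T ?R"
    using continuous_map_compose[OF _ continuous_map_column_shear[of a ?K]]
      continuous_map_compose[OF _ continuous_map_row_shear[of a ?K]]
    by (auto simp: o_def intro: continuous_map_minus)
  have h: "continuous_map ?TO T h"
    unfolding h_def
    by (intro continuous_map_group_mult[OF tg] C R continuous_map_from_subtopology) (simp add: id_def[symmetric])
  have "prod e UNIV = e a * prod e (- {a})"
    by (subst prod.remove[of _ a]) (auto simp: Compl_eq_Diff_UNIV)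
  also have "prod e (- {a}) = (\<Prod>k\<in>-{a}. 2)" by (rule prod.cong) (auto simp: e_def)
  also have "\<dots> = 2 ^ (CARD('n) - 1)" by (simp add: Compl_eq_Diff_UNIV card_Diff_singleton)
  finally have "det (diagonal e) = 1"
    by (simp add: det_diagonal_prod e_def power_mult_distrib[symmetric])
  then have dS: "diagonal e \<in> S" by (rule det_1_mem)
  have e1: "1 - e k \<noteq> 0" for k
  proof -
    have "(1/2 :: real) ^ (CARD('n) - 1) \<le> (1/2) ^ 1"
      using two_le_card by (intro power_decreasing) auto
    then show ?thesis by (auto simp: e_def)
  qed
  let ?d = "linear_part (diagonal e)"
  have "continuous_map ?TO T (\<lambda>p. h p \<otimes>\<^bsub>G\<^esub> ?d \<otimes>\<^bsub>G\<^esub> inv\<^bsub>G\<^esub> (?d \<otimes>\<^bsub>G\<^esub> h p))"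
    using linear_part_carrier[OF dS] top
    by (intro continuous_map_group_mult[OF tg] continuous_map_group_inv[OF tg] h) auto
  then have "continuous_map ?TO T (\<lambda>p. translation (fst (h p) - diagonal e *v fst (h p)))"
  proof (rule continuous_map_eq)
    fix p assume p: "p \<in> topspace ?TO"
    then have a: "snd p $ a $ a \<noteq> 0" by auto
    have hG: "h p \<in> carrier G" using continuous_map_funspace[OF h] p top by auto
    interpret group G by (rule group_semidirect)
    \<comment> \<open>The condition says that exactly one of \<open>k\<close> and \<open>l\<close>
      is \<open>a\<close>; these are the entries outside the two blocks.\<close>
    have "snd (h p) $ k $ l = 0" if "k = a \<longleftrightarrow> l \<noteq> a" for k l
      using a that
      by (cases "k = a") (auto simp: h_def linear_part_def column_shear_mult mult_row_shear c_def r_def)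
    then have "snd (h p) $ k $ l * e l = e k * snd (h p) $ k $ l" for k l
      by (cases "k = a \<longleftrightarrow> l \<noteq> a") (auto simp: e_def)
    then have comm: "snd (h p) ** diagonal e = diagonal e ** snd (h p)"
      by (simp add: vec_eq_iff diagonal_mult mult_diagonal)
    have "h p \<otimes>\<^bsub>G\<^esub> ?d = translation (fst (h p) - diagonal e *v fst (h p)) \<otimes>\<^bsub>G\<^esub> (?d \<otimes>\<^bsub>G\<^esub> h p)"
      by (simp add: linear_part_def translation_def comm)
    then show "h p \<otimes>\<^bsub>G\<^esub> ?d \<otimes>\<^bsub>G\<^esub> inv\<^bsub>G\<^esub> (?d \<otimes>\<^bsub>G\<^esub> h p) = translation (fst (h p) - diagonal e *v fst (h p))"
      using inv_solve_right'[of _ "h p \<otimes>\<^bsub>G\<^esub> ?d" "?d \<otimes>\<^bsub>G\<^esub> h p"] hG linear_part_carrier[OF dS]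
        translation_carrier m_closed by metis
  qed
  then have "continuous_map ?TO translation_topology (\<lambda>p. fst (h p) - diagonal e *v fst (h p))"
    unfolding translation_topology_def by (intro continuous_map_into_pullback) auto
  moreover have "continuous_map euclidean euclidean (\<lambda>x :: real^'n. \<chi> k. x $ k / (1 - e k))"
    using e1 by (auto intro!: continuous_intros)
  ultimately have "continuous_map ?TO euclidean
      (\<lambda>p. \<chi> k. (fst (h p) - diagonal e *v fst (h p)) $ k / (1 - e k))"
    unfolding translation_topology_eq_euclidean by (rule continuous_map_compose[unfolded o_def])
  moreover have "(\<chi> k. (x - diagonal e *v x) $ k / (1 - e k)) = x" for x :: "real^'n"
    using e1 by (simp add: vec_eq_iff diagonal_vector field_simps)
  ultimately have "continuous_map ?TO translation_topology (\<lambda>p. fst (h p))"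
    by (simp add: translation_topology_eq_euclidean)
  \<comment> \<open>Right multiplication by \<open>?R p\<close> leaves the translation part alone,
    while \<open>?C p\<close> applies its shear to it. Negating the vector \<open>c p\<close>
    inverts the shear.\<close>
  from continuous_map_linear_action[OF C' this]
  have "continuous_map ?TO euclidean (\<lambda>p. column_shear a ?K (- c p) *v fst (h p))"
    by (simp add: linear_part_def translation_topology_eq_euclidean)
  moreover have "column_shear a ?K (- c p) *v fst (h p) = fst p" for p
    by (simp add: h_def linear_part_def vec_eq_iff column_shear_vector)
  ultimately show ?thesis by simp
qed

text \<open>The chart is \<open>T\<close>-open because the matrix is continuous, and it contains the
  identity. Left translation by \<open>p\<close> acts on translation parts by the affine map
  \<open>x \<mapsto> fst p + snd p *v x\<close>, so continuity on the chart gives continuity near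
  \<open>p\<close>.\<close>

lemma continuous_map_fst_euclidean: "continuous_map T euclidean fst"
proof -
  obtain a :: 'n where True by blast
  let ?O = "{p :: (real^'n) \<times> (real^'n^'n). snd p $ a $ a \<noteq> 0}"
  let ?TO = "subtopology T ?O"
  have "openin T {p \<in> topspace T. snd p \<in> {A. A $ a $ a \<noteq> 0}}"
    by (intro openin_continuous_map_preimage[OF continuous_map_snd_euclidean])
      (auto intro!: open_Collect_neq continuous_intros)
  then have O: "openin T (topspace T \<inter> ?O)" by (simp add: Collect_conj_eq[symmetric] Int_def)
  have TO: "openin T W" if "openin ?TO W" for W
  proof -
    have "\<exists>V. openin T V \<and> W = V \<inter> ?O" using that by (simp only: openin_subtopology)
    then obtain V where V: "openin T V \<and> W = V \<inter> ?O" ..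
    then have "W = V \<inter> (topspace T \<inter> ?O)" using openin_subset[of T V] by auto
    then show ?thesis using openin_Int[OF _ O, of V] V by simp
  qed
  show ?thesis unfolding continuous_map_alt
  proof (intro conjI allI impI)
    fix U :: "(real^'n) set" assume U: "openin euclidean U"
    show "openin T (fst -` U \<inter> topspace T)"
    proof (subst openin_subopen, intro ballI)
      fix p assume p: "p \<in> fst -` U \<inter> topspace T"
      then have pG: "p \<in> carrier G" and sp: "snd p \<in> S" by (auto simp: top)
      have hom: "homeomorphic_map T T (\<lambda>q. p \<otimes>\<^bsub>G\<^esub> q)"
        by (rule homeomorphic_map_left_translation[OF tg pG])
      let ?W = "{q \<in> topspace ?TO. fst p + snd p *v fst q \<in> U}"
      have "continuous_map ?TO euclidean (\<lambda>q. snd p *v fst q)"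
        using continuous_map_const_linear[OF sp, of ?TO fst] continuous_map_fst_chart[of a]
        by (simp add: translation_topology_eq_euclidean)
      moreover have "continuous_map euclidean euclidean (\<lambda>x :: real^'n. fst p + x)"
        by (auto intro!: continuous_intros)
      ultimately have "continuous_map ?TO euclidean (\<lambda>q. fst p + snd p *v fst q)"
        using continuous_map_compose[of ?TO euclidean "\<lambda>q. snd p *v fst q" euclidean] by (simp add: o_def)
      then have "openin ?TO ?W" using U by (intro openin_continuous_map_preimage)
      then have "openin T ((\<lambda>q. p \<otimes>\<^bsub>G\<^esub> q) ` ?W)"
        using homeomorphic_map_openin_image[OF hom] TO by blast
      moreover have one: "\<one>\<^bsub>G\<^esub> \<in> ?W" using p one_mem by (simp add: top) (auto simp: mat_def)
      have "p \<in> (\<lambda>q. p \<otimes>\<^bsub>G\<^esub> q) ` ?W"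
        by (rule image_eqI[OF _ one]) (simp only: monoid.r_one[OF group.is_monoid[OF group_semidirect] pG])
      moreover have "(\<lambda>q. p \<otimes>\<^bsub>G\<^esub> q) ` ?W \<subseteq> fst -` U \<inter> topspace T"
        using sp by (auto simp: top mult_closed)
      ultimately show "\<exists>V. openin T V \<and> p \<in> V \<and> V \<subseteq> fst -` U \<inter> topspace T" by blast
    qed
  qed auto
qed

lemma semidirect_topology_eq:
  assumes "polish_group G (semidirect_topology S)"
  shows "T = semidirect_topology S"
proof (rule polish_group_topology_unique[OF polish assms])
  have "continuous_map T (top_of_set S) snd"
    by (rule continuous_map_into_subtopology[OF continuous_map_snd_euclidean]) (auto simp: top)
  then have "continuous_map T (semidirect_topology S) (\<lambda>x. (fst x, snd x))"
    unfolding semidirect_topology_def by (intro continuous_map_pairedI continuous_map_fst_euclidean)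
  then show "continuous_map T (semidirect_topology S) (\<lambda>x. x)" by simp
qed

end

section \<open>The usual topology is a Polish group topology\<close>

lemma continuous_on_det: "continuous_on X f \<Longrightarrow> continuous_on X (\<lambda>x. det (f x :: real^'n^'n))"
  unfolding det_def by (intro continuous_intros)

text \<open>Cramer's rule for the \<open>l\<close>-th column of the inverse. It exhibits the entries
  as quotients of polynomials, from which continuity of inversion follows.\<close>

lemma matrix_inv_nth:
  fixes A :: "real^'n^'n"
  assumes "det A \<noteq> 0"
  shows "matrix_inv A $ k $ l = det (\<chi> i j. if j = k then (if i = l then 1 else 0) else A $ i $ j) / det A"
proof -
  have "A *v (matrix_inv A *v axis l 1) = axis l 1"
    by (simp add: matrix_vector_mul_assoc matrix_inv_inverse[OF assms])
  then have "matrix_inv A *v axis l 1 = (\<chi> k. det (\<chi> i j. if j = k then axis l 1 $ i else A $ i $ j) / det A)"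
    using cramer[OF assms] by blast
  then have "(matrix_inv A *v axis l 1) $ k = det (\<chi> i j. if j = k then axis l 1 $ i else A $ i $ j) / det A"
    by simp
  moreover have "axis l 1 $ i = (if i = l then 1 else 0 :: real)" for i by (auto simp: axis_def)
  ultimately show ?thesis by (simp add: matrix_vector_mult_basis column_def cong: if_cong)
qed

context matrix_group
begin

lemma continuous_on_matrix_inv: "continuous_on S matrix_inv"
proof -
  have "continuous_on S (\<lambda>A. \<chi> k l. det (\<chi> i j. if j = k then (if i = l then 1 else 0) else A $ i $ j) / det A)"
  proof (intro continuous_on_vec_lambda continuous_on_divide continuous_on_det)
    fix k l i j :: 'n
    show "continuous_on S (\<lambda>A. if j = k then (if i = l then 1 else 0) else A $ i $ j)"
      by (cases "j = k") (auto intro!: continuous_intros)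
  qed (auto simp: det_nz intro!: continuous_intros)
  then show ?thesis
    by (rule continuous_on_eq) (simp add: vec_eq_iff matrix_inv_nth det_nz)
qed

lemma polish_semidirect_topology:
  assumes "completely_metrizable_space (top_of_set S)"
  shows "polish_group G (semidirect_topology S)"
  unfolding polish_group_def topological_group_def
proof (intro conjI)
  \<comment> \<open>As a subspace of a Euclidean space, the group lets its operations be treated by
    \<open>continuous_on\<close>.\<close>
  have ST: "semidirect_topology S = top_of_set (UNIV \<times> S)"
    by (simp add: semidirect_topology_def prod_topology_subtopology(2) euclidean_product_topology)
  show "group G" by (rule group_semidirect)
  show "topspace (semidirect_topology S) = carrier G" by (simp add: ST)
  show "separable_space (semidirect_topology S)"
    unfolding semidirect_topology_def
    by (intro second_countable_imp_separable_space second_countable_prod_topology second_countable_subtopology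
        second_countable_euclidean)
  show "completely_metrizable_space (semidirect_topology S)"
    unfolding semidirect_topology_def using assms
    by (simp add: completely_metrizable_space_prod_topology completely_metrizable_space_euclidean)
  have mv: "continuous_on X (\<lambda>z. f z *v g z)" if "continuous_on X f" "continuous_on X g"
    for X :: "'z::topological_space set" and f :: "'z \<Rightarrow> real^'n^'n" and g
    unfolding matrix_vector_mult_def using that by (intro continuous_intros)
  have mm: "continuous_on X (\<lambda>z. f z ** g z)" if "continuous_on X f" "continuous_on X g"
    for X :: "'z::topological_space set" and f g :: "'z \<Rightarrow> real^'n^'n"
    unfolding matrix_matrix_mult_def using that by (intro continuous_intros)
  show "continuous_map (prod_topology (semidirect_topology S) (semidirect_topology S)) (semidirect_topology S)
      (\<lambda>(x, y). x \<otimes>\<^bsub>G\<^esub> y)"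
    unfolding ST subtopology_Times[symmetric] euclidean_product_topology
    by (auto simp: case_prod_unfold mult_closed intro!: continuous_intros mv mm)
  show "continuous_map (semidirect_topology S) (semidirect_topology S) (\<lambda>x. inv\<^bsub>G\<^esub> x)"
  proof (rule continuous_map_eq)
    have "continuous_on (UNIV \<times> S) (\<lambda>p :: (real^'n) \<times> (real^'n^'n). matrix_inv (snd p))"
      by (rule continuous_on_compose2[OF continuous_on_matrix_inv]) (auto intro!: continuous_intros)
    then show "continuous_map (semidirect_topology S) (semidirect_topology S)
        (\<lambda>p. (- (matrix_inv (snd p) *v fst p), matrix_inv (snd p)))"
      unfolding ST by (auto simp: inv_closed intro!: continuous_intros mv)
  qed (auto simp: ST inv_semidirect)
qed

end

text \<open>Conditions on the determinant make \<open>GL\<close> and \<open>GL_pos\<close> open and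
  \<open>SL\<close> and \<open>abs_SL\<close> closed among all matrices; open and closed subsets of
  a completely metrizable space are both completely metrizable.\<close>

lemma matrix_group_cases:
  fixes S :: "(real^'n^'n) set"
  assumes "CARD('n) \<ge> 2" "S \<in> {GL, SL, abs_SL, GL_pos}"
  shows "matrix_group S" "completely_metrizable_space (top_of_set S)"
proof -
  have GL: "GL = {A :: real^'n^'n. det A \<noteq> 0}" by (simp add: GL_def invertible_det_nz)
  have inv: "det (matrix_inv A) = 1 / det A" if "det A \<noteq> 0" for A :: "real^'n^'n"
    by (rule det_matrix_inv[OF that])
  show "matrix_group S"
    by unfold_locales (use assms in \<open>auto simp: GL SL_def abs_SL_def GL_pos_def det_mul inv abs_mult\<close>)
  have det: "continuous_on UNIV (\<lambda>A :: real^'n^'n. det A)"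
    by (intro continuous_on_det continuous_on_id)
  have "open S \<or> closed S"
  proof -
    have "open (GL :: (real^'n^'n) set)" unfolding GL by (intro open_Collect_neq det continuous_intros)
    moreover have "SL = {A :: real^'n^'n. det A = 1}" "abs_SL = {A :: real^'n^'n. \<bar>det A\<bar> = 1}"
      "GL_pos = {A :: real^'n^'n. 0 < det A}"
      by (auto simp: GL SL_def abs_SL_def GL_pos_def)
    moreover have "closed {A :: real^'n^'n. det A = 1}" "closed {A :: real^'n^'n. \<bar>det A\<bar> = 1}"
      "open {A :: real^'n^'n. 0 < det A}"
      by (intro closed_Collect_eq open_Collect_less continuous_intros det)+
    ultimately show ?thesis using assms by auto
  qed
  then show "completely_metrizable_space (top_of_set S)"
    using completely_metrizable_space_openin completely_metrizable_space_closedin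
      completely_metrizable_space_euclidean open_openin closed_closedin by metis
qed

section \<open>Transport along the isomorphism and conclusion\<close>

text \<open>Topologies pull back against the direction of a map, so the one on \<open>L\<close> is
  moved to \<open>G\<close> along the inverse of \<phi>; that inverse is a homeomorphism by
  construction, and \<phi> agrees with its inverse on the carrier.\<close>

lemma polish_group_transport:
  assumes L: "polish_group L TL" and G: "group G" and \<phi>: "\<phi> \<in> iso L G"
  obtains T where "polish_group G T" "homeomorphic_map TL T \<phi>"
proof -
  let ?\<psi> = "inv_into (carrier L) \<phi>"
  have tg: "topological_group L TL" using L polish_groupD by blast
  note L' = topological_groupD[OF tg]
  have bij: "bij_betw \<phi> (carrier L) (carrier G)" using \<phi> by (simp add: iso_def)
  have \<psi>: "?\<psi> \<in> iso G L" by (rule group.iso_set_sym[OF L'(1) \<phi>])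
  let ?T = "pullback_topology (carrier G) ?\<psi> TL"
  have im: "?\<psi> ` carrier G = carrier L" and inj: "inj_on ?\<psi> (carrier G)"
    using \<psi> by (auto simp: iso_def bij_betw_def)
  have T: "polish_group G ?T"
    using \<psi> inj im L'(2) closedin_topspace[of TL]
    by (intro polish_group_pullback[OF L G]) (auto simp: iso_def)
  have hom: "homeomorphic_map ?T TL ?\<psi>"
    using homeomorphic_map_pullback[OF inj, of TL] im L'(2) by (metis order_refl subtopology_topspace)
  have topT: "topspace ?T = carrier G"
    using \<psi> by (intro topspace_pullback_hom[OF L'(2)]) (simp add: iso_def)
  obtain g where g: "homeomorphic_maps ?T TL ?\<psi> g" using hom homeomorphic_map_maps by blast
  have "homeomorphic_map TL ?T g" using g homeomorphic_maps_sym homeomorphic_map_maps by blast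
  moreover have "g x = \<phi> x" if "x \<in> topspace TL" for x
  proof -
    have "\<phi> x \<in> carrier G" "?\<psi> (\<phi> x) = x"
      using that bij L'(2) by (auto simp: bij_betw_def inv_into_f_f)
    then show ?thesis using g topT unfolding homeomorphic_maps_def by metis
  qed
  ultimately have "homeomorphic_map TL ?T \<phi>" by (rule homeomorphic_map_eq)
  with T show thesis by (rule that)
qed

theorem theorem1:
  fixes S :: "(real^'n^'n) set"
  assumes "CARD('n) \<ge> 2"
    and "S \<in> {GL, SL, abs_SL, GL_pos}"
  shows "(\<forall>(L :: 'l monoid) TL \<phi>.
            polish_group L TL \<longrightarrow> \<phi> \<in> iso L (semidirect S) \<longrightarrow>
            topological_iso L TL (semidirect S) (semidirect_topology S) \<phi>)
         \<and> polish_group (semidirect S) (semidirect_topology S)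
         \<and> algebraically_determined TYPE('l) (semidirect S) (semidirect_topology S)"
proof -
  interpret matrix_group S by (rule matrix_group_cases[OF assms])
  have usual: "polish_group G (semidirect_topology S)"
    by (rule polish_semidirect_topology[OF matrix_group_cases(2)[OF assms]])
  have "topological_iso L TL G (semidirect_topology S) \<phi>"
    if L: "polish_group L TL" and \<phi>: "\<phi> \<in> iso L G" for L :: "'l monoid" and TL \<phi>
  proof -
    obtain T where T: "polish_group G T" "homeomorphic_map TL T \<phi>"
      using polish_group_transport[OF L group_semidirect \<phi>] .
    interpret polish_semidirect S T by unfold_locales (rule T(1))
    show ?thesis using T(2) \<phi> semidirect_topology_eq[OF usual] by (simp add: topological_iso_def)
  qed
  then show ?thesis using usual by (simp add: algebraically_determined_def)
qed

end
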